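(* Let $n\ge1$, let $T$ be the $2n\times 2$ matrix with rows $[x_i,y_i]$, $i=1,\dots,2n$, where the $x_i,y_i$ are independent indeterminates, and let $\Delta_i=x_{2i-1}y_{2i}+x_{2i}y_{2i-1}$ for $i=1,\dots,n$. Then $$ M(AD_{n};\mathrm{z}_T)=2^{n-1}\prod_{i=1}^n\Delta_i \prod_{\substack{1\le i\le 2n\\ i\neq2,\,2n-1}}x_i^{n/2}y_i^{n/2-1}\;M(AD_{n-2};\mathrm{z}_{\mathrm{t}(T)}) $$ for $n$ even, and $$ M(AD_{n};\mathrm{z}_T)=2^{n-1}\prod_{i=1}^n\Delta_i \prod_{\substack{1\le i\le 2n\\ i\neq2,\,2n-1}}x_i^{(n-1)/2}y_i^{(n-1)/2}\; M(AD_{n-2};\mathrm{z}_{\mathrm{t}(T)}) $$ for $n$ odd (where for $n=1$ the factor $M(AD_{n-2};\mathrm{z}_{\mathrm{t}(T)})$ is interpreted as $1$).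
   Context: For $n\ge0$, the Aztec diamond graph $AD_n$ has vertices $u_{i,j}$ ($0\le i\le n$, $1\le j\le n$) and $v_{i,j}$ ($1\le i\le n$, $0\le j\le n$), and $4n^2$ edges $\epsilon_{r,s}$, $1\le r,s\le 2n$ (the edge centers form a $2n\times2n$ array), where for $1\le i,j\le n$: $\epsilon_{2i-1,2j-1}=u_{i-1,j}v_{i,j-1}$, $\epsilon_{2i-1,2j}=u_{i-1,j}v_{i,j}$, $\epsilon_{2i,2j-1}=u_{i,j}v_{i,j-1}$, $\epsilon_{2i,2j}=u_{i,j}v_{i,j}$. $AD_0$ is the empty graph. The weight of a perfect matching is the product of the weights of its edges, and $M(G;\mathrm{wt})$ is the sum of the weights of all perfect matchings of $G$ (equal to $1$ for the empty graph). For a $2n\times2$ matrix $T$ with rows $[x_i,y_i]$, $\mathrm{z}_T$ is the weight on $AD_n$ assigning to $\epsilon_{r,s}$ the value $x_r$, $y_r$, $y_r$, $x_r$ according as $s\equiv 1,2,3,0 \pmod 4$. For $n\ge2$ the operator $\mathrm{t}$ sends $T$ to the $(2n-4)\times2$ matrix $\mathrm{t}(T)$ whose row $2k-1$ is $[\,1/x_{2k+2},\ 1/y_{2k+2}\,]$ and whose row $2k$ is $[\,1/x_{2k+1},\ 1/y_{2k+1}\,]$, for $k=1,\dots,n-2$. *)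

theory Defs
  imports "HOL-Library.Poly_Mapping" "HOL-Computational_Algebra.Fraction_Field"
begin

subsection \<open>Independent indeterminates\<close>

text \<open>Rational functions over a field in countably many indeterminates, as the fraction field of
  the polynomial ring. A polynomial maps finitely many monomials to nonzero coefficients, and a
  monomial maps finitely many variable indices to nonzero exponents.\<close>

type_synonym 'k ratfun = "((nat \<Rightarrow>\<^sub>0 nat) \<Rightarrow>\<^sub>0 'k) fract"

definition indet :: "nat \<Rightarrow> 'k::field ratfun" where
  "indet v = Fract (Poly_Mapping.single (Poly_Mapping.single v 1) 1) 1"

text \<open>The two families use disjoint sets of variable indices, so that together they consist of
  pairwise distinct indeterminates.\<close>

definition indet_x :: "nat \<Rightarrow> 'k::field ratfun" where
  "indet_x i = indet (2 * i)"

definition indet_y :: "nat \<Rightarrow> 'k::field ratfun" where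
  "indet_y i = indet (2 * i + 1)"


subsection \<open>Perfect matchings of simple graphs\<close>

definition perfect_matchings :: "'v set \<Rightarrow> 'v set set \<Rightarrow> 'v set set set" where
  "perfect_matchings V E = {N. N \<subseteq> E \<and> (\<forall>v\<in>V. \<exists>!e. e \<in> N \<and> v \<in> e)}"

definition matching_sum ::
    "'v set \<Rightarrow> 'v set set \<Rightarrow> ('v set \<Rightarrow> 'a::comm_semiring_1) \<Rightarrow> 'a" where
  "matching_sum V E wt = (\<Sum>N\<in>perfect_matchings V E. \<Prod>e\<in>N. wt e)"


subsection \<open>Aztec diamond graphs\<close>

datatype vertex = U nat nat | V nat nat

definition AD_vertices :: "nat \<Rightarrow> vertex set" where
  "AD_vertices n = {U i j | i j. i \<le> n \<and> 1 \<le> j \<and> j \<le> n} \<union> {V i j | i j. 1 \<le> i \<and> i \<le> n \<and> j \<le> n}"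

definition AD_edge :: "nat \<Rightarrow> nat \<Rightarrow> vertex set" where
  "AD_edge r s =
    (let i = (r + 1) div 2; j = (s + 1) div 2
     in {U (if odd r then i - 1 else i) j, V i (if odd s then j - 1 else j)})"

definition AD_edges :: "nat \<Rightarrow> vertex set set" where
  "AD_edges n = {AD_edge r s | r s. r \<in> {1..2*n} \<and> s \<in> {1..2*n}}"

lemma AD_edge_simps:
  assumes "i \<ge> 1" "j \<ge> 1"
  shows "AD_edge (2*i-1) (2*j-1) = {U (i-1) j, V i (j-1)}"
    and "AD_edge (2*i-1) (2*j) = {U (i-1) j, V i j}"
    and "AD_edge (2*i) (2*j-1) = {U i j, V i (j-1)}"
    and "AD_edge (2*i) (2*j) = {U i j, V i j}"
  using assms by (auto simp: AD_edge_def Let_def)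

lemma AD_edge_inject: "AD_edge r s = AD_edge r' s' \<longleftrightarrow> r = r' \<and> s = s'"
proof
  assume *: "AD_edge r s = AD_edge r' s'"
  have "(r + 1) div 2 = (r' + 1) div 2" "(s + 1) div 2 = (s' + 1) div 2"
    using * by (auto simp: AD_edge_def Let_def doubleton_eq_iff)
  moreover have "odd r = odd r'" "odd s = odd s'"
    using * by (auto simp: AD_edge_def Let_def doubleton_eq_iff elim!: oddE evenE split: if_splits)
  ultimately show "r = r' \<and> s = s'" by presburger
qed auto


subsection \<open>Weights and the operator on weight matrices\<close>

text \<open>A matrix with two columns is given by its rows, as pairs, indexed from 1. For a
  \<open>2n \<times> 2\<close> matrix only rows \<open>1, \<dots>, 2n\<close> are meaningful; the remaining ones are
  arbitrary and never used by the weight on the Aztec diamond of order \<open>n\<close>.\<close>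

text \<open>The description below determines the weight, since the edge determines its position
  \<open>(r, s)\<close> in the array.\<close>

definition z_weight :: "(nat \<Rightarrow> 'a \<times> 'a) \<Rightarrow> vertex set \<Rightarrow> 'a" where
  "z_weight T e =
    (THE w. \<exists>r s. e = AD_edge r s \<and> w = (if s mod 4 \<in> {1, 0} then fst (T r) else snd (T r)))"

lemma z_weight_AD_edge:
  "z_weight T (AD_edge r s) = (if s mod 4 \<in> {1, 0} then fst (T r) else snd (T r))"
  unfolding z_weight_def AD_edge_inject by (rule the_equality) auto

abbreviation M_AD :: "nat \<Rightarrow> (nat \<Rightarrow> 'a \<times> 'a) \<Rightarrow> 'a::comm_semiring_1" where
  "M_AD n T \<equiv> matching_sum (AD_vertices n) (AD_edges n) (z_weight T)"

text \<open>Row \<open>2k - 1\<close> comes from row \<open>2k + 2 = (2k - 1) + 3\<close> and row \<open>2k\<close> from row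
  \<open>2k + 1\<close>. On a \<open>2n \<times> 2\<close> matrix the result has \<open>2n - 4\<close> meaningful rows.\<close>

definition t_op :: "(nat \<Rightarrow> 'a \<times> 'a) \<Rightarrow> nat \<Rightarrow> 'a::field \<times> 'a" where
  "t_op T r =
    (let (x, y) = T (if odd r then r + 3 else r + 1) in (1 / x, 1 / y))"

lemma t_op_simps:
  assumes "k \<ge> 1"
  shows "t_op T (2*k-1) = (1 / fst (T (2*k+2)), 1 / snd (T (2*k+2)))"
    and "t_op T (2*k) = (1 / fst (T (2*k+1)), 1 / snd (T (2*k+1)))"
proof -
  have "odd (2*k-1)" "2*k-1+3 = 2*k+2" using assms by auto
  then show "t_op T (2*k-1) = (1 / fst (T (2*k+2)), 1 / snd (T (2*k+2)))"
    by (simp only: t_op_def if_True) (simp add: case_prod_beta Let_def)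
  show "t_op T (2*k) = (1 / fst (T (2*k+1)), 1 / snd (T (2*k+1)))"
    by (simp add: t_op_def case_prod_beta Let_def)
qed

end

theory Submission
  imports Defs "HOL-Library.FuncSet"
begin

text \<open>The edges of \<open>AD\<^sub>n\<close> split into \<open>n\<^sup>2\<close> four-cycles (cells), and a perfect matching assigns each vertex
  to the cell of the edge covering it. In a cell with cross sum \<open>\<Delta> = ad + bc\<close>, the matchings of a
  set \<open>S\<close> of corners are \<open>\<Delta>\<close> times those of the complementary corners, provided each edge weight is
  replaced by that of the opposite edge divided by \<open>\<Delta>\<close>. Complementing all assignments at once
  therefore turns \<open>M(AD\<^sub>n)\<close> into the product of all \<open>\<Delta>\<close> times the matching sum of the graph of
  interior vertices, which is a copy of \<open>AD\<^sub>n\<^sub>-\<^sub>1\<close> with the roles of \<open>u\<close> and \<open>v\<close> exchanged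
  (urban renewal). For \<open>z\<^sub>T\<close> the cross sum of a cell depends only on its row, so a second
  step applies; after it the weight is that of \<open>t(T)\<close> up to the constant factor \<open>1/2\<close>. In
  characteristic 2 the second step would divide by zero, but then both sides vanish: having more
  than \<open>2n\<^sup>2\<close> vertices, every perfect matching fills some cell, whose cross sum is \<open>0\<close>.\<close>

subsection \<open>Matching sums of graphs partitioned into cells\<close>

lemma perfect_matchings_subset_Pow:
  "perfect_matchings W E \<subseteq> Pow E"
  by (auto simp: perfect_matchings_def)

lemma finite_perfect_matchings: "finite E \<Longrightarrow> finite (perfect_matchings W E)"
  by (rule finite_subset[OF perfect_matchings_subset_Pow]) simp

lemma matching_sum_cong:
  assumes "\<And>e. e \<in> E \<Longrightarrow> wt e = wt' e"
  shows "matching_sum W E wt = matching_sum W E wt'"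
  unfolding matching_sum_def using assms
  by (intro sum.cong prod.cong refl) (auto simp: perfect_matchings_def)

lemma matching_sum_empty [simp]: "matching_sum {} {} wt = 1"
  by (simp add: matching_sum_def perfect_matchings_def)

text \<open>\<open>A c\<close> stands for the set of vertices that a matching covers by edges of
  cell \<open>c\<close>. Taking extensional functions leaves finitely many assignments and lets a
  matching determine its assignment.\<close>

definition cell_assignments :: "'c set \<Rightarrow> ('c \<Rightarrow> 'v set) \<Rightarrow> 'v set \<Rightarrow> ('c \<Rightarrow> 'v set) set" where
  "cell_assignments C X W = {A \<in> (\<Pi>\<^sub>E c\<in>C. Pow (X c)). \<forall>v\<in>W. \<exists>!c. c \<in> C \<and> v \<in> A c}"

lemma cell_assignmentsD:
  assumes "A \<in> cell_assignments C X W"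
  shows "c \<in> C \<Longrightarrow> A c \<subseteq> X c" "v \<in> W \<Longrightarrow> \<exists>!c. c \<in> C \<and> v \<in> A c"
   "c \<notin> C \<Longrightarrow> A c = undefined"
  using assms by (auto simp: cell_assignments_def PiE_def Pi_def extensional_def)

text \<open>Cutting a perfect matching along the disjoint edge sets \<open>F c\<close> gives in each
  cell a perfect matching of the vertices covered there. Conversely, such local matchings glue
  together, because an assignment gives every vertex of \<open>W\<close> to exactly one cell.
  Summing first over the assignment and then over the local matchings yields the product.\<close>

lemma matching_sum_cells:
  fixes wt :: "'v set \<Rightarrow> 'a::comm_semiring_1"
  assumes fin: "finite C" "\<And>c. c \<in> C \<Longrightarrow> finite (X c)" "\<And>c. c \<in> C \<Longrightarrow> finite (F c)"
    and disj: "\<And>c c'. c \<in> C \<Longrightarrow> c' \<in> C \<Longrightarrow> c \<noteq> c' \<Longrightarrow> F c \<inter> F c' = {}"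
    and FX: "\<And>c. c \<in> C \<Longrightarrow> \<Union>(F c) \<subseteq> X c"
    and XV: "\<And>c. c \<in> C \<Longrightarrow> X c \<subseteq> W"
  shows "matching_sum W (\<Union>c\<in>C. F c) wt =
    (\<Sum>A\<in>cell_assignments C X W. \<Prod>c\<in>C. matching_sum (A c) {e \<in> F c. e \<subseteq> A c} wt)"
proof -
  let ?E = "\<Union>c\<in>C. F c"
  let ?P = "\<lambda>A c. perfect_matchings (A c) {e \<in> F c. e \<subseteq> A c}"
  have finA: "finite (cell_assignments C X W)"
    by (rule finite_subset[of _ "\<Pi>\<^sub>E c\<in>C. Pow (X c)"])
      (auto simp: cell_assignments_def intro!: finite_PiE fin)
  have finP: "finite (?P A c)" if "c \<in> C" for A c
    using that fin by (auto intro!: finite_perfect_matchings)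
  have "(\<Sum>A\<in>cell_assignments C X W. \<Prod>c\<in>C. matching_sum (A c) {e \<in> F c. e \<subseteq> A c} wt)
      = (\<Sum>A\<in>cell_assignments C X W. \<Sum>N\<in>(\<Pi>\<^sub>E c\<in>C. ?P A c). \<Prod>c\<in>C. \<Prod>e\<in>N c. wt e)"
    unfolding matching_sum_def by (intro sum.cong refl prod_sum_PiE fin finP)
  also have "\<dots> = (\<Sum>(A,N)\<in>(SIGMA A:cell_assignments C X W. \<Pi>\<^sub>E c\<in>C. ?P A c).
      \<Prod>c\<in>C. \<Prod>e\<in>N c. wt e)" (is "_ = sum _ ?S")
    by (rule sum.Sigma) (auto intro!: finA finite_PiE fin finP)
  also have "\<dots> = (\<Sum>N\<in>perfect_matchings W ?E. \<Prod>e\<in>N. wt e)"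
  proof -
    \<comment> \<open>\<open>i\<close> cuts a matching into its assignment and local pieces.
      \<open>j\<close> glues the pieces and may forget the assignment, since \<open>A c\<close> is
      the union of the edges in \<open>N c\<close>.\<close>
    define i where "i = (\<lambda>N. (\<lambda>c\<in>C. \<Union>(N \<inter> F c), \<lambda>c\<in>C. N \<inter> F c))"
    define j where "j = (\<lambda>(A :: 'b \<Rightarrow> 'v set, N). \<Union>c\<in>C. N c :: 'v set set)"
    have 1: "i (j (A,N)) = (A,N) \<and> j (A,N) \<in> perfect_matchings W ?E \<and>
        (\<Prod>e\<in>j (A,N). wt e) = (\<Prod>c\<in>C. \<Prod>e\<in>N c. wt e)"
      if A: "A \<in> cell_assignments C X W" and N: "N \<in> (\<Pi>\<^sub>E c\<in>C. ?P A c)" for A N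
    proof (intro conjI)
      note AD = cell_assignmentsD[OF A]
      have NF: "N c \<subseteq> F c" "\<And>e. e \<in> N c \<Longrightarrow> e \<subseteq> A c"
        "\<And>v. v \<in> A c \<Longrightarrow> \<exists>!e. e \<in> N c \<and> v \<in> e" if "c \<in> C" for c
        using N that by (auto simp: PiE_def Pi_def perfect_matchings_def)
      have Next: "N c = undefined" if "c \<notin> C" for c
        using N that by (auto simp: PiE_def extensional_def)
      have cell: "(\<Union>c\<in>C. N c) \<inter> F c = N c" if "c \<in> C" for c
        using NF(1) disj that by blast
      have un: "\<Union>(N c) = A c" if "c \<in> C" for c
        using NF(2,3)[OF that] by blast
      show "i (j (A, N)) = (A, N)"
        unfolding i_def j_def by (auto simp: fun_eq_iff restrict_def cell un AD(3) Next)
      show "j (A, N) \<in> perfect_matchings W ?E"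
        unfolding perfect_matchings_def j_def prod.case
      proof (intro CollectI conjI ballI)
        show "(\<Union>c\<in>C. N c) \<subseteq> ?E" using NF(1) by blast
        fix v assume "v \<in> W"
        then obtain c where c: "c \<in> C" "v \<in> A c" "\<And>c'. c' \<in> C \<Longrightarrow> v \<in> A c' \<Longrightarrow> c' = c"
          using AD(2) by metis
        from NF(3)[OF c(1,2)] obtain e where e: "e \<in> N c" "v \<in> e" "\<And>e'. e' \<in> N c \<Longrightarrow> v \<in> e' \<Longrightarrow> e' = e"
          by metis
        show "\<exists>!e. e \<in> (\<Union>c\<in>C. N c) \<and> v \<in> e"
          using c e NF(2) by (intro ex1I[of _ e]) blast+
      qed
      show "(\<Prod>e\<in>j (A, N). wt e) = (\<Prod>c\<in>C. \<Prod>e\<in>N c. wt e)"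
        unfolding j_def prod.case
      proof (rule prod.UNION_disjoint[OF fin(1)])
        show "\<forall>c\<in>C. finite (N c)" using NF(1) fin(3) finite_subset by metis
        show "\<forall>c\<in>C. \<forall>c'\<in>C. c \<noteq> c' \<longrightarrow> N c \<inter> N c' = {}"
          using NF(1) disj by (metis inf_mono subset_empty)
      qed
    qed
    have 2: "j (i N) = N \<and> i N \<in> ?S" if N: "N \<in> perfect_matchings W ?E" for N
    proof -
      from N have NE: "N \<subseteq> ?E" and N1: "\<And>v. v \<in> W \<Longrightarrow> \<exists>!e. e \<in> N \<and> v \<in> e"
        by (auto simp: perfect_matchings_def)
      have "j (i N) = N" unfolding i_def j_def using NE by auto
      moreover have "(\<lambda>c\<in>C. \<Union>(N \<inter> F c)) \<in> cell_assignments C X W"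
        unfolding cell_assignments_def
      proof (intro CollectI conjI ballI)
        show "(\<lambda>c\<in>C. \<Union>(N \<inter> F c)) \<in> (\<Pi>\<^sub>E c\<in>C. Pow (X c))" using FX by auto
        fix v assume "v \<in> W"
        from N1[OF this] obtain e where e: "e \<in> N" "v \<in> e" "\<And>e'. e' \<in> N \<Longrightarrow> v \<in> e' \<Longrightarrow> e' = e"
          by metis
        from e(1) NE obtain c where c: "c \<in> C" "e \<in> F c" by auto
        show "\<exists>!c. c \<in> C \<and> v \<in> (\<lambda>c\<in>C. \<Union>(N \<inter> F c)) c"
        proof (rule ex1I[of _ c])
          show "c \<in> C \<and> v \<in> (\<lambda>c\<in>C. \<Union>(N \<inter> F c)) c" using e(1,2) c by auto
          fix c' assume c': "c' \<in> C \<and> v \<in> (\<lambda>c\<in>C. \<Union>(N \<inter> F c)) c'"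
          then have "e \<in> F c'" using e(3) by auto
          then show "c' = c" using disj[of c' c] c c' by auto
        qed
      qed
      moreover have "(\<lambda>c\<in>C. N \<inter> F c) \<in> (\<Pi>\<^sub>E c\<in>C. ?P (\<lambda>c\<in>C. \<Union>(N \<inter> F c)) c)"
      proof (intro PiE_I)
        fix c assume c: "c \<in> C"
        have "\<exists>!e. e \<in> N \<inter> F c \<and> v \<in> e" if "v \<in> \<Union>(N \<inter> F c)" for v
        proof -
          have "v \<in> W" using that FX XV c by blast
          then show ?thesis using N1 that by blast
        qed
        then show "(\<lambda>c\<in>C. N \<inter> F c) c \<in> ?P (\<lambda>c\<in>C. \<Union>(N \<inter> F c)) c"
          using c by (auto simp: perfect_matchings_def)
      qed auto
      ultimately show ?thesis by (simp add: i_def)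
    qed
    show ?thesis
      by (rule sum.reindex_bij_witness[where i = i and j = j]) (use 1 2 in auto)
  qed
  finally show ?thesis by (simp add: matching_sum_def)
qed

subsection \<open>Four-cycles\<close>

text \<open>The arguments are in cyclic order, so \<open>{a,b}\<close> and \<open>{c,d}\<close> are
  opposite edges, and so are \<open>{b,c}\<close> and \<open>{d,a}\<close>.\<close>

definition cycle4 :: "'v \<Rightarrow> 'v \<Rightarrow> 'v \<Rightarrow> 'v \<Rightarrow> 'v set set" where
  "cycle4 a b c d = {{a,b},{b,c},{c,d},{d,a}}"

text \<open>Adjacent edges share a vertex, which leaves seven matchings of the four-cycle; each one
  is perfect exactly on the set that it covers.\<close>

lemma perfect_matchings_cycle4:
  assumes "distinct [a,b,c,d]"
  shows "perfect_matchings S {e \<in> cycle4 a b c d. e \<subseteq> S} =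
    {N \<in> {{},{{a,b}},{{b,c}},{{c,d}},{{d,a}},{{a,b},{c,d}},{{b,c},{d,a}}}. S = \<Union>N}"
    (is "?L = ?R")
proof (intro equalityI subsetI)
  fix N assume "N \<in> ?L"
  then have N: "N \<subseteq> cycle4 a b c d" "\<Union>N \<subseteq> S" "\<And>v. v \<in> S \<Longrightarrow> \<exists>!e. e \<in> N \<and> v \<in> e"
    by (auto simp: perfect_matchings_def)
  have S: "\<Union>N = S" using N(2,3) by blast
  have uni: "e = e'" if "e \<in> N" "e' \<in> N" "v \<in> e" "v \<in> e'" for e e' v
    using N(3)[of v] that S by blast
  have n1: "\<not> ({a,b} \<in> N \<and> {b,c} \<in> N)"
    using uni[of "{a,b}" "{b,c}" b] assms by (auto simp: doubleton_eq_iff)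
  have n2: "\<not> ({b,c} \<in> N \<and> {c,d} \<in> N)"
    using uni[of "{b,c}" "{c,d}" c] assms by (auto simp: doubleton_eq_iff)
  have n3: "\<not> ({c,d} \<in> N \<and> {d,a} \<in> N)"
    using uni[of "{c,d}" "{d,a}" d] assms by (auto simp: doubleton_eq_iff)
  have n4: "\<not> ({d,a} \<in> N \<and> {a,b} \<in> N)"
    using uni[of "{d,a}" "{a,b}" a] assms by (auto simp: doubleton_eq_iff)
  \<comment> \<open>Of the sixteen ways to choose edges, the four exclusions \<open>n1\<close> to
    \<open>n4\<close> leave the seven listed sets.\<close>
  have "N = (if {a,b} \<in> N then {{a,b}} else {}) \<union> (if {b,c} \<in> N then {{b,c}} else {}) \<union>
     (if {c,d} \<in> N then {{c,d}} else {}) \<union> (if {d,a} \<in> N then {{d,a}} else {})"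
    using N(1) by (auto simp: cycle4_def)
  then have "N \<in> {{},{{a,b}},{{b,c}},{{c,d}},{{d,a}},{{a,b},{c,d}},{{b,c},{d,a}}}"
    using n1 n2 n3 n4
    by (cases "{a,b} \<in> N"; cases "{b,c} \<in> N"; cases "{c,d} \<in> N"; cases "{d,a} \<in> N")
      (simp_all add: insert_commute)
  with S show "N \<in> ?R" by blast
next
  fix N assume "N \<in> ?R"
  then have S: "S = \<Union>N"
    and N: "N \<in> {{},{{a,b}},{{b,c}},{{c,d}},{{d,a}},{{a,b},{c,d}},{{b,c},{d,a}}}" by auto
  have "N \<subseteq> cycle4 a b c d" using N by (auto simp: cycle4_def)
  moreover have "e = e'" if "e \<in> N" "e' \<in> N" "v \<in> e" "v \<in> e'" for e e' v
    using N that assms by auto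
  ultimately show "N \<in> ?L" unfolding S perfect_matchings_def by blast
qed

text \<open>Only the full corner set has two perfect matchings. Writing the result as a sum of
  conditionals allows both sides of the complementation identity to be compared term by
  term.\<close>

lemma matching_sum_cycle4:
  fixes wt :: "'v set \<Rightarrow> 'a::comm_semiring_1"
  assumes "distinct [a,b,c,d]"
  shows "matching_sum S {e \<in> cycle4 a b c d. e \<subseteq> S} wt =
     (if S = {} then 1 else 0)
   + (if S = {a,b} then wt {a,b} else 0) + (if S = {b,c} then wt {b,c} else 0)
   + (if S = {c,d} then wt {c,d} else 0) + (if S = {d,a} then wt {d,a} else 0)
   + (if S = {a,b,c,d} then wt {a,b} * wt {c,d} + wt {b,c} * wt {d,a} else 0)"
proof -
  let ?M = "{{},{{a,b}},{{b,c}},{{c,d}},{{d,a}},{{a,b},{c,d}},{{b,c},{d,a}}}"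
  have ne: "a \<noteq> b" "a \<noteq> c" "a \<noteq> d" "b \<noteq> c" "b \<noteq> d" "c \<noteq> d"
    "b \<noteq> a" "c \<noteq> a" "d \<noteq> a" "c \<noteq> b" "d \<noteq> b" "d \<noteq> c"
    using assms by auto
  have "matching_sum S {e \<in> cycle4 a b c d. e \<subseteq> S} wt =
      (\<Sum>N\<in>?M. if S = \<Union>N then \<Prod>e\<in>N. wt e else 0)"
    unfolding matching_sum_def perfect_matchings_cycle4[OF assms] by (rule sum.inter_filter) simp
  also have "\<dots> = (if S = {} then 1 else 0)
   + ((if S = {a,b} then wt {a,b} else 0) + ((if S = {b,c} then wt {b,c} else 0)
   + ((if S = {c,d} then wt {c,d} else 0) + ((if S = {d,a} then wt {d,a} else 0)
   + ((if S = {a,b} \<union> {c,d} then wt {a,b} * wt {c,d} else 0)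
   + (if S = {b,c} \<union> {d,a} then wt {b,c} * wt {d,a} else 0))))))"
    using ne by (simp add: doubleton_eq_iff insert_eq_iff del: Un_insert_left Un_insert_right split del: if_split cong: if_cong)
  also have "{a,b} \<union> {c,d} = {a,b,c,d}" by auto
  also have "{b,c} \<union> {d,a} = {a,b,c,d}" by auto
  also have "(if S = {a,b,c,d} then wt {a,b} * wt {c,d} else 0)
   + (if S = {a,b,c,d} then wt {b,c} * wt {d,a} else 0)
    = (if S = {a,b,c,d} then wt {a,b} * wt {c,d} + wt {b,c} * wt {d,a} else 0)" by simp
  finally show ?thesis by (simp only: add.assoc)
qed

text \<open>Complementing corners swaps the empty set with the full one and each edge with its
  opposite edge; every other \<open>S\<close> contributes zero on both sides. The rescaled opposite
  weights \<open>wt'\<close> are chosen to make these swaps exact.\<close>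

lemma matching_sum_cycle4_complement:
  fixes wt wt' :: "'v set \<Rightarrow> 'a::field"
  assumes dist: "distinct [a,b,c,d]" and S: "S \<subseteq> {a,b,c,d}"
    and \<Delta>: "\<Delta> = wt {a,b} * wt {c,d} + wt {b,c} * wt {d,a}" "\<Delta> \<noteq> 0"
    and wt': "wt' {a,b} = wt {c,d} / \<Delta>" "wt' {b,c} = wt {d,a} / \<Delta>"
      "wt' {c,d} = wt {a,b} / \<Delta>" "wt' {d,a} = wt {b,c} / \<Delta>"
  shows "matching_sum S {e \<in> cycle4 a b c d. e \<subseteq> S} wt = \<Delta> *
    matching_sum ({a,b,c,d} - S) {e \<in> cycle4 a b c d. e \<subseteq> {a,b,c,d} - S} wt'"
proof -
  let ?X = "{a,b,c,d}"
  have c: "?X - S = B \<longleftrightarrow> S = D" if "?X - B = D" "?X - D = B" for B D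
    using that S by blast
  have compl: "?X - S = {} \<longleftrightarrow> S = ?X" "?X - S = ?X \<longleftrightarrow> S = {}"
    "?X - S = {a,b} \<longleftrightarrow> S = {c,d}" "?X - S = {b,c} \<longleftrightarrow> S = {d,a}"
    "?X - S = {c,d} \<longleftrightarrow> S = {a,b}" "?X - S = {d,a} \<longleftrightarrow> S = {b,c}"
    using dist by (intro c; auto)+
  \<comment> \<open>This settles empty \<open>S\<close>: the cross sum of the new weights is
    \<open>1 / \<Delta>\<close>.\<close>
  have D: "\<Delta> * (wt' {a,b} * wt' {c,d} + wt' {b,c} * wt' {d,a}) = 1"
  proof -
    have "wt' {a,b} * wt' {c,d} + wt' {b,c} * wt' {d,a} =
        (wt {c,d} * wt {a,b} + wt {d,a} * wt {b,c}) / (\<Delta> * \<Delta>)"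
      unfolding wt' by (simp add: add_divide_distrib)
    also have "wt {c,d} * wt {a,b} + wt {d,a} * wt {b,c} = \<Delta>"
      by (simp add: \<Delta>(1) mult.commute)
    finally show ?thesis using \<Delta>(2) by simp
  qed
  have D': "\<Delta> * wt' {a,b} = wt {c,d}" "\<Delta> * wt' {b,c} = wt {d,a}"
      "\<Delta> * wt' {c,d} = wt {a,b}" "\<Delta> * wt' {d,a} = wt {b,c}"
    using \<Delta>(2) by (simp_all add: wt')
  have sums: "matching_sum (?X - S) {e \<in> cycle4 a b c d. e \<subseteq> ?X - S} wt' =
     (if S = ?X then 1 else 0)
   + (if S = {c,d} then wt' {a,b} else 0) + (if S = {d,a} then wt' {b,c} else 0)
   + (if S = {a,b} then wt' {c,d} else 0) + (if S = {b,c} then wt' {d,a} else 0)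
   + (if S = {} then wt' {a,b} * wt' {c,d} + wt' {b,c} * wt' {d,a} else 0)"
    unfolding matching_sum_cycle4[OF dist] compl by (simp only: ac_simps)
  have "\<Delta> * matching_sum (?X - S) {e \<in> cycle4 a b c d. e \<subseteq> ?X - S} wt' =
     (if S = ?X then \<Delta> else 0)
   + (if S = {c,d} then \<Delta> * wt' {a,b} else 0) + (if S = {d,a} then \<Delta> * wt' {b,c} else 0)
   + (if S = {a,b} then \<Delta> * wt' {c,d} else 0) + (if S = {b,c} then \<Delta> * wt' {d,a} else 0)
   + (if S = {} then \<Delta> * (wt' {a,b} * wt' {c,d} + wt' {b,c} * wt' {d,a}) else 0)"
    unfolding sums by (simp only: distrib_left if_distrib[of "(*) \<Delta>"] mult_zero_right mult_1_right)
  also have "\<dots> = matching_sum S {e \<in> cycle4 a b c d. e \<subseteq> S} wt"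
    unfolding matching_sum_cycle4[OF dist] D D' \<Delta>(1)[symmetric] by (simp only: ac_simps)
  finally show ?thesis by simp
qed

subsection \<open>Complementation\<close>

text \<open>With two candidates, unique existence is an exclusive or, which survives negating
  \<open>P\<close> at both. This is why complementation preserves valid assignments at a vertex
  shared by two cells.\<close>

lemma ex1_two_cases:
  assumes "c \<noteq> c'" "c \<in> C" "c' \<in> C" "\<And>d. d \<in> C \<Longrightarrow> P d \<Longrightarrow> d = c \<or> d = c'"
  shows "(\<exists>!d. d \<in> C \<and> P d) \<longleftrightarrow> (P c \<longleftrightarrow> \<not> P c')"
proof -
  have "d \<in> C \<and> P d \<longleftrightarrow> d = c \<and> P c \<or> d = c' \<and> P c'" for d
    using assms by blast
  then show ?thesis using assms(1) by auto
qed

text \<open>The maps \<open>p\<close>, \<open>q\<close>, \<open>r\<close>, \<open>s\<close> give the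
  corners of a cell in cyclic order. Different cells may share corners but no edge.\<close>

locale cellular_graph =
  fixes C :: "'c set" and p q r s :: "'c \<Rightarrow> 'v"
  assumes finite_cells: "finite C"
    and distinct_corners: "c \<in> C \<Longrightarrow> distinct [p c, q c, r c, s c]"
    and disjoint_cells: "c \<in> C \<Longrightarrow> c' \<in> C \<Longrightarrow> c \<noteq> c' \<Longrightarrow>
      cycle4 (p c) (q c) (r c) (s c) \<inter> cycle4 (p c') (q c') (r c') (s c') = {}"
begin

definition corners :: "'c \<Rightarrow> 'v set" where
  "corners c = {p c, q c, r c, s c}"

definition cell_edges :: "'c \<Rightarrow> 'v set set" where
  "cell_edges c = cycle4 (p c) (q c) (r c) (s c)"

definition graph_vertices :: "'v set" where
  "graph_vertices = (\<Union>c\<in>C. corners c)"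

definition graph_edges :: "'v set set" where
  "graph_edges = (\<Union>c\<in>C. cell_edges c)"

definition cells_at :: "'v \<Rightarrow> 'c set" where
  "cells_at v = {c \<in> C. v \<in> corners c}"

definition interior_vertices :: "'v set" where
  "interior_vertices = {v. card (cells_at v) = 2}"

text \<open>This is the matching sum of the whole four-cycle, the cross sum \<Delta> of the
  cell.\<close>

definition cell_weight :: "('v set \<Rightarrow> 'a::comm_semiring_1) \<Rightarrow> 'c \<Rightarrow> 'a" where
  "cell_weight wt c = wt {p c, q c} * wt {r c, s c} + wt {q c, r c} * wt {s c, p c}"

lemma finite_corners [simp]: "finite (corners c)"
  by (simp add: corners_def)

lemma finite_cell_edges [simp]: "finite (cell_edges c)"
  by (simp add: cell_edges_def cycle4_def)

lemma Union_cell_edges: "\<Union>(cell_edges c) = corners c"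
  by (auto simp: cell_edges_def cycle4_def corners_def)

lemma matching_sum_graph:
  "matching_sum graph_vertices graph_edges wt =
    (\<Sum>A\<in>cell_assignments C corners graph_vertices.
      \<Prod>c\<in>C. matching_sum (A c) {e \<in> cell_edges c. e \<subseteq> A c} wt)"
  unfolding graph_edges_def
  by (rule matching_sum_cells)
    (auto simp: finite_cells Union_cell_edges graph_vertices_def
      disjoint_cells[folded cell_edges_def])

text \<open>As \<open>A c\<close> contains only interior vertices, the condition
  \<open>e \<subseteq> A c\<close> already forces an edge to be interior. The summands therefore get
  the same form as in \<open>matching_sum_graph\<close>.\<close>

lemma matching_sum_interior:
  "matching_sum interior_vertices {e \<in> graph_edges. e \<subseteq> interior_vertices} wt =
    (\<Sum>A\<in>cell_assignments C (\<lambda>c. corners c \<inter> interior_vertices) interior_vertices.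
      \<Prod>c\<in>C. matching_sum (A c) {e \<in> cell_edges c. e \<subseteq> A c} wt)"
proof -
  let ?F = "\<lambda>c. {e \<in> cell_edges c. e \<subseteq> interior_vertices}"
  have disj: "?F c \<inter> ?F c' = {}" if "c \<in> C" "c' \<in> C" "c \<noteq> c'" for c c'
    using disjoint_cells[OF that] by (auto simp: cell_edges_def)
  have sub: "\<Union>(?F c) \<subseteq> corners c \<inter> interior_vertices" for c
    using Union_cell_edges[of c] by blast
  have "{e \<in> graph_edges. e \<subseteq> interior_vertices} = (\<Union>c\<in>C. ?F c)"
    by (auto simp: graph_edges_def)
  then have "matching_sum interior_vertices {e \<in> graph_edges. e \<subseteq> interior_vertices} wt =
    (\<Sum>A\<in>cell_assignments C (\<lambda>c. corners c \<inter> interior_vertices) interior_vertices.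
      \<Prod>c\<in>C. matching_sum (A c) {e \<in> ?F c. e \<subseteq> A c} wt)"
    by (simp only:) (rule matching_sum_cells[OF finite_cells _ _ disj sub Int_lower2]; simp)
  also have "\<dots> = (\<Sum>A\<in>cell_assignments C (\<lambda>c. corners c \<inter> interior_vertices) interior_vertices.
      \<Prod>c\<in>C. matching_sum (A c) {e \<in> cell_edges c. e \<subseteq> A c} wt)"
  proof (intro sum.cong prod.cong refl)
    fix A c assume "A \<in> cell_assignments C (\<lambda>c. corners c \<inter> interior_vertices) interior_vertices" "c \<in> C"
    then have "A c \<subseteq> interior_vertices" using cell_assignmentsD(1) by fast
    then have "{e \<in> ?F c. e \<subseteq> A c} = {e \<in> cell_edges c. e \<subseteq> A c}" by blast
    then show "matching_sum (A c) {e \<in> ?F c. e \<subseteq> A c} wt =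
        matching_sum (A c) {e \<in> cell_edges c. e \<subseteq> A c} wt" by simp
  qed
  finally show ?thesis .
qed

text \<open>Ciucu's complementation theorem for graphs whose cells are four-cycles.\<close>

theorem matching_sum_complement:
  fixes wt wt' :: "'v set \<Rightarrow> 'a::field"
  assumes two: "\<And>v. v \<in> graph_vertices \<Longrightarrow> card (cells_at v) \<le> 2"
    and nz: "\<And>c. c \<in> C \<Longrightarrow> cell_weight wt c \<noteq> 0"
    and wt': "\<And>c. c \<in> C \<Longrightarrow> wt' {p c, q c} = wt {r c, s c} / cell_weight wt c"
      "\<And>c. c \<in> C \<Longrightarrow> wt' {q c, r c} = wt {s c, p c} / cell_weight wt c"
      "\<And>c. c \<in> C \<Longrightarrow> wt' {r c, s c} = wt {p c, q c} / cell_weight wt c"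
      "\<And>c. c \<in> C \<Longrightarrow> wt' {s c, p c} = wt {q c, r c} / cell_weight wt c"
  shows "matching_sum graph_vertices graph_edges wt = (\<Prod>c\<in>C. cell_weight wt c) *
    matching_sum interior_vertices {e \<in> graph_edges. e \<subseteq> interior_vertices} wt'"
proof -
  let ?M = "\<lambda>c S w. matching_sum S {e \<in> cell_edges c. e \<subseteq> S} w"
  let ?A = "cell_assignments C corners graph_vertices"
  let ?B = "cell_assignments C (\<lambda>c. corners c \<inter> interior_vertices) interior_vertices"
  define co where "co = (\<lambda>A. \<lambda>c\<in>C. corners c - A c)"
  have cases: "(\<exists>c. cells_at v = {c} \<and> v \<notin> interior_vertices) \<or>
      (\<exists>c c'. c \<noteq> c' \<and> cells_at v = {c,c'} \<and> v \<in> interior_vertices)"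
    if "v \<in> graph_vertices" for v
  proof -
    have "finite (cells_at v)" "cells_at v \<noteq> {}"
      using that finite_cells by (auto simp: cells_at_def graph_vertices_def)
    then have "card (cells_at v) \<noteq> 0" by simp
    with two[OF that] consider "card (cells_at v) = 1" | "card (cells_at v) = 2" by linarith
    then show ?thesis
    proof cases
      case 1
      then show ?thesis by (auto simp: interior_vertices_def card_1_singleton_iff)
    next
      case 2
      then show ?thesis by (auto simp: interior_vertices_def card_2_iff)
    qed
  qed
  have int: "interior_vertices \<subseteq> graph_vertices"
  proof
    fix v assume "v \<in> interior_vertices"
    then have "cells_at v \<noteq> {}" by (auto simp: interior_vertices_def)
    then show "v \<in> graph_vertices" by (auto simp: cells_at_def graph_vertices_def)
  qed
  have at: "c \<in> cells_at v \<longleftrightarrow> c \<in> C \<and> v \<in> corners c" for c v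
    by (auto simp: cells_at_def)
  have AB: "co A \<in> ?B" "co (co A) = A" if "A \<in> ?A" for A
  proof -
    note AD = cell_assignmentsD[OF that]
    \<comment> \<open>A corner not assigned to \<open>c\<close> must be assigned to another cell,
      hence lies in two cells.\<close>
    have sub: "corners c - A c \<subseteq> interior_vertices" if "c \<in> C" for c
    proof
      fix v assume v: "v \<in> corners c - A c"
      then have vg: "v \<in> graph_vertices" using \<open>c \<in> C\<close> by (auto simp: graph_vertices_def)
      obtain c' where c': "c' \<in> C" "v \<in> A c'" using AD(2)[OF vg] by blast
      have "c' \<noteq> c" "c \<in> cells_at v" "c' \<in> cells_at v" using c' v \<open>c \<in> C\<close> AD(1) by (auto simp: at)
      then show "v \<in> interior_vertices" using cases[OF vg] by force
    qed
    show "co A \<in> ?B" unfolding cell_assignments_def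
    proof (intro CollectI conjI ballI)
      show "co A \<in> (\<Pi>\<^sub>E c\<in>C. Pow (corners c \<inter> interior_vertices))"
        using sub by (auto simp: co_def)
      fix v assume v: "v \<in> interior_vertices"
      then obtain c c' where c: "c \<noteq> c'" "cells_at v = {c,c'}"
        using cases int by blast
      have C: "c \<in> C" "c' \<in> C" "v \<in> corners c" "v \<in> corners c'"
        and only: "\<And>d. d \<in> C \<Longrightarrow> v \<in> corners d \<Longrightarrow> d = c \<or> d = c'"
        using c(2) at by blast+
      have "(\<exists>!d. d \<in> C \<and> v \<in> A d) \<longleftrightarrow> (v \<in> A c \<longleftrightarrow> v \<notin> A c')"
        using only AD(1) by (intro ex1_two_cases c(1) C) blast
      moreover have "(\<exists>!d. d \<in> C \<and> v \<in> co A d) \<longleftrightarrow> (v \<in> co A c \<longleftrightarrow> v \<notin> co A c')"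
        using only by (intro ex1_two_cases c(1) C) (auto simp: co_def)
      ultimately show "\<exists>!d. d \<in> C \<and> v \<in> co A d"
        using AD(2)[of v] v int C by (auto simp: co_def)
    qed
    show "co (co A) = A"
      using AD(1,3) by (auto simp: co_def fun_eq_iff restrict_def)
  qed
  have BA: "co B \<in> ?A" "co (co B) = B" if "B \<in> ?B" for B
  proof -
    note BD = cell_assignmentsD[OF that]
    show "co B \<in> ?A" unfolding cell_assignments_def
    proof (intro CollectI conjI ballI)
      show "co B \<in> (\<Pi>\<^sub>E c\<in>C. Pow (corners c))" by (auto simp: co_def)
      fix v assume "v \<in> graph_vertices"
      from cases[OF this] show "\<exists>!d. d \<in> C \<and> v \<in> co B d"
      proof (elim disjE exE conjE)
        fix c assume c: "cells_at v = {c}" "v \<notin> interior_vertices"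
        have C: "c \<in> C" "v \<in> corners c" and only: "\<And>d. d \<in> C \<Longrightarrow> v \<in> corners d \<Longrightarrow> d = c"
          using c(1) at by blast+
        \<comment> \<open>A vertex of a single cell is never in \<open>B c\<close>, so the
          complement always assigns it to that cell.\<close>
        have "v \<notin> B c" using BD(1)[OF C(1)] c(2) by blast
        then have "v \<in> co B c" using C by (simp add: co_def)
        moreover have "d = c" if "d \<in> C" "v \<in> co B d" for d
          using only[of d] that by (simp add: co_def)
        ultimately show ?thesis using C(1) by blast
      next
        fix c c' assume c: "c \<noteq> c'" "cells_at v = {c,c'}" "v \<in> interior_vertices"
        have C: "c \<in> C" "c' \<in> C" "v \<in> corners c" "v \<in> corners c'"
          and only: "\<And>d. d \<in> C \<Longrightarrow> v \<in> corners d \<Longrightarrow> d = c \<or> d = c'"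
          using c(2) at by blast+
        have "(\<exists>!d. d \<in> C \<and> v \<in> B d) \<longleftrightarrow> (v \<in> B c \<longleftrightarrow> v \<notin> B c')"
          using only BD(1) by (intro ex1_two_cases c(1) C) blast
        moreover have "(\<exists>!d. d \<in> C \<and> v \<in> co B d) \<longleftrightarrow> (v \<in> co B c \<longleftrightarrow> v \<notin> co B c')"
          using only by (intro ex1_two_cases c(1) C) (auto simp: co_def)
        ultimately show ?thesis
          using BD(2)[OF c(3)] C by (simp add: co_def)
      qed
    qed
    show "co (co B) = B"
      using BD(1,3) by (auto simp: co_def fun_eq_iff restrict_def)
  qed
  have "matching_sum graph_vertices graph_edges wt = (\<Sum>A\<in>?A. \<Prod>c\<in>C. ?M c (A c) wt)"
    by (rule matching_sum_graph)
  also have "\<dots> = (\<Sum>A\<in>?A. \<Prod>c\<in>C. cell_weight wt c * ?M c (co A c) wt')"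
  proof (intro sum.cong prod.cong refl)
    fix A c assume A: "A \<in> ?A" and c: "c \<in> C"
    have "A c \<subseteq> {p c, q c, r c, s c}"
      using cell_assignmentsD(1)[OF A c] by (simp add: corners_def)
    then show "?M c (A c) wt = cell_weight wt c * ?M c (co A c) wt'"
      using matching_sum_cycle4_complement[OF distinct_corners[OF c], of "A c" "cell_weight wt c" wt wt']
        nz[OF c] wt'[OF c] c
      by (simp add: cell_weight_def cell_edges_def co_def corners_def)
  qed
  also have "\<dots> = (\<Sum>B\<in>?B. \<Prod>c\<in>C. cell_weight wt c * ?M c (B c) wt')"
    by (rule sum.reindex_bij_witness[where i = co and j = co]) (use AB BA in auto)
  also have "\<dots> = (\<Prod>c\<in>C. cell_weight wt c) * (\<Sum>B\<in>?B. \<Prod>c\<in>C. ?M c (B c) wt')"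
    by (simp add: prod.distrib sum_distrib_left)
  finally show ?thesis by (simp add: matching_sum_interior)
qed

text \<open>By pigeonhole, some cell of every assignment receives at least three corners. Three
  corners admit no perfect matching, and all four contribute the cell weight, which is zero.\<close>

theorem matching_sum_eq_0:
  fixes wt :: "'v set \<Rightarrow> 'a::comm_semiring_1"
  assumes zero: "\<And>c. c \<in> C \<Longrightarrow> cell_weight wt c = 0"
    and many: "card graph_vertices > 2 * card C"
  shows "matching_sum graph_vertices graph_edges wt = 0"
  unfolding matching_sum_graph
proof (rule sum.neutral, rule ballI)
  fix A assume A: "A \<in> cell_assignments C corners graph_vertices"
  note AD = cell_assignmentsD[OF A]
  have "graph_vertices \<subseteq> (\<Union>c\<in>C. A c)" using AD(2) by blast
  moreover have fin: "finite (A c)" if "c \<in> C" for c by (rule finite_subset[OF AD(1)[OF that] finite_corners])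
  ultimately have "card graph_vertices \<le> card (\<Union>c\<in>C. A c)"
    using finite_cells by (intro card_mono) auto
  also have "\<dots> \<le> (\<Sum>c\<in>C. card (A c))" by (rule card_UN_le[OF finite_cells])
  finally have "(\<Sum>c\<in>C. card (A c)) > (\<Sum>c\<in>C. 2)" using many by simp
  then obtain c where c: "c \<in> C" "card (A c) > 2" by (meson leI sum_mono not_less)
  have "A c \<noteq> B" if "card B \<le> 2" for B using that c(2) by auto
  then have "A c \<noteq> {}" "\<And>v w. A c \<noteq> {v,w}" by (auto simp: card_insert_if)
  then have "matching_sum (A c) {e \<in> cell_edges c. e \<subseteq> A c} wt = 0"
    unfolding cell_edges_def matching_sum_cycle4[OF distinct_corners[OF c(1)]]
    using zero[OF c(1)] by (simp add: cell_weight_def)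
  with c(1) show "(\<Prod>c\<in>C. matching_sum (A c) {e \<in> cell_edges c. e \<subseteq> A c} wt) = 0"
    using finite_cells by (intro prod_zero) auto
qed

end

subsection \<open>Isomorphic and rescaled graphs\<close>

lemma matching_sum_image:
  assumes "inj f"
  shows "matching_sum (f ` W) ((`) f ` E) wt = matching_sum W E (\<lambda>e. wt (f ` e))"
proof -
  have inj1: "inj ((`) f)" using assms by (simp add: inj_def inj_image_eq_iff)
  then have inj2: "inj ((`) ((`) f))" by (simp add: inj_def inj_image_eq_iff)
  have ex1: "(\<exists>!e. e \<in> (`) f ` N \<and> f v \<in> e) \<longleftrightarrow> (\<exists>!e. e \<in> N \<and> v \<in> e)" for N v
  proof -
    have iff: "f v \<in> f ` e \<longleftrightarrow> v \<in> e" for e by (rule inj_image_mem_iff[OF assms])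
    have eq: "e = e'" if "f ` e = f ` e'" for e e' using that inj_image_eq_iff[OF assms] by blast
    show ?thesis
    proof
      assume *: "\<exists>!e. e \<in> (`) f ` N \<and> f v \<in> e"
      then obtain e where e: "e \<in> N" "v \<in> e" using iff by blast
      show "\<exists>!e. e \<in> N \<and> v \<in> e"
      proof (rule ex1I[of _ e])
        fix e' assume "e' \<in> N \<and> v \<in> e'"
        then have "f ` e' \<in> (`) f ` N \<and> f v \<in> f ` e'" "f ` e \<in> (`) f ` N \<and> f v \<in> f ` e" using e by auto
        with * show "e' = e" by (intro eq) blast
      qed (use e in simp)
    next
      assume "\<exists>!e. e \<in> N \<and> v \<in> e"
      then obtain e where e: "e \<in> N" "v \<in> e" "\<And>e'. e' \<in> N \<and> v \<in> e' \<Longrightarrow> e' = e" by blast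
      show "\<exists>!e. e \<in> (`) f ` N \<and> f v \<in> e"
      proof (rule ex1I[of _ "f ` e"])
        fix e' assume "e' \<in> (`) f ` N \<and> f v \<in> e'"
        then obtain d where "d \<in> N" "e' = f ` d" "v \<in> d" using iff by blast
        then show "e' = f ` e" using e(3) by simp
      qed (use e(1,2) in simp)
    qed
  qed
  have "perfect_matchings (f ` W) ((`) f ` E) = (`) ((`) f) ` perfect_matchings W E"
  proof (intro equalityI subsetI)
    fix M assume M: "M \<in> perfect_matchings (f ` W) ((`) f ` E)"
    then have "M \<subseteq> (`) f ` E" by (simp add: perfect_matchings_def)
    then obtain N where N: "N \<subseteq> E" "M = (`) f ` N" by (auto simp: subset_image_iff)
    then have "N \<in> perfect_matchings W E"
      using M by (simp add: perfect_matchings_def ex1)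
    then show "M \<in> (`) ((`) f) ` perfect_matchings W E" using N by blast
  next
    fix M assume "M \<in> (`) ((`) f) ` perfect_matchings W E"
    then obtain N where "N \<in> perfect_matchings W E" "M = (`) f ` N" by blast
    then show "M \<in> perfect_matchings (f ` W) ((`) f ` E)"
      by (simp add: perfect_matchings_def ex1 image_mono)
  qed
  then have "matching_sum (f ` W) ((`) f ` E) wt =
      (\<Sum>N\<in>perfect_matchings W E. \<Prod>e\<in>(`) f ` N. wt e)"
    unfolding matching_sum_def by (simp add: sum.reindex inj_on_subset[OF inj2])
  also have "\<dots> = matching_sum W E (\<lambda>e. wt (f ` e))"
    unfolding matching_sum_def by (simp add: prod.reindex inj_on_subset[OF inj1])
  finally show ?thesis .
qed

text \<open>A perfect matching covers each vertex of \<open>W\<close> exactly once, so the vertex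
  factors contribute the same product to every matching.\<close>

lemma matching_sum_scale:
  assumes "finite W" and "\<And>e. e \<in> E \<Longrightarrow> e \<subseteq> W"
  shows "matching_sum W E (\<lambda>e. (\<Prod>v\<in>e. f v) * wt e) = (\<Prod>v\<in>W. f v) * matching_sum W E wt"
proof -
  have "(\<Prod>e\<in>N. \<Prod>v\<in>e. f v) = (\<Prod>v\<in>W. f v)" if N: "N \<in> perfect_matchings W E" for N
  proof -
    have sub: "e \<subseteq> W" if "e \<in> N" for e
      using N that assms(2) by (auto simp: perfect_matchings_def)
    have ex1: "\<exists>!e. e \<in> N \<and> v \<in> e" if "v \<in> W" for v
      using N that by (auto simp: perfect_matchings_def)
    have un: "\<Union>N = W" using sub ex1 by blast
    have "e \<inter> e' = {}" if "e \<in> N" "e' \<in> N" "e \<noteq> e'" for e e'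
      using that sub[OF that(1)] ex1 by blast
    then have "(\<Prod>v\<in>\<Union>N. f v) = (\<Prod>e\<in>N. \<Prod>v\<in>e. f v)"
      using finite_subset[OF sub assms(1)] by (subst prod.Union_disjoint) auto
    then show ?thesis by (simp add: un)
  qed
  then show ?thesis
    unfolding matching_sum_def by (simp add: prod.distrib sum_distrib_left)
qed

subsection \<open>Array weights on Aztec diamonds\<close>

text \<open>Weights with arbitrary values at the positions of the edge array: the weight between the
  two reductions follows a different column pattern from \<open>z_weight\<close>.\<close>

definition array_weight :: "(nat \<Rightarrow> nat \<Rightarrow> 'a) \<Rightarrow> vertex set \<Rightarrow> 'a" where
  "array_weight w e = (THE z. \<exists>r s. e = AD_edge r s \<and> z = w r s)"

lemma array_weight_AD_edge [simp]: "array_weight w (AD_edge r s) = w r s"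
  unfolding array_weight_def AD_edge_inject by (rule the_equality) auto

definition AD_sum :: "nat \<Rightarrow> (nat \<Rightarrow> nat \<Rightarrow> 'a::comm_semiring_1) \<Rightarrow> 'a" where
  "AD_sum n w = matching_sum (AD_vertices n) (AD_edges n) (array_weight w)"

lemma M_AD_eq_AD_sum:
  "M_AD n T = AD_sum n (\<lambda>r s. if s mod 4 \<in> {1, 0} then fst (T r) else snd (T r))"
  unfolding AD_sum_def z_weight_def array_weight_def ..

lemma AD_sum_cong:
  assumes "\<And>r s. r \<in> {1..2*n} \<Longrightarrow> s \<in> {1..2*n} \<Longrightarrow> w r s = w' r s"
  shows "AD_sum n w = AD_sum n w'"
  unfolding AD_sum_def using assms by (intro matching_sum_cong) (auto simp: AD_edges_def)

lemma AD_sum_0 [simp]: "AD_sum 0 w = 1"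
  by (simp add: AD_sum_def AD_vertices_def AD_edges_def)

lemma AD_vertices_eq:
  "AD_vertices n = (\<lambda>(i,j). U i j) ` ({..n} \<times> {1..n}) \<union> (\<lambda>(i,j). V i j) ` ({1..n} \<times> {..n})"
  by (auto simp: AD_vertices_def)

lemma finite_AD_vertices [simp]: "finite (AD_vertices n)"
  by (simp add: AD_vertices_eq)

lemma card_AD_vertices: "card (AD_vertices n) = 2 * (n * (n + 1))"
  unfolding AD_vertices_eq
  by (subst card_Un_disjoint) (auto simp: card_image inj_on_def)

lemma AD_edge_subset:
  assumes "e \<in> AD_edges n"
  shows "e \<subseteq> AD_vertices n"
proof -
  from assms obtain r s where e: "e = AD_edge r s" and rs: "r \<in> {1..2*n}" "s \<in> {1..2*n}"
    by (auto simp: AD_edges_def)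
  from rs have "1 \<le> (r + 1) div 2" "(r + 1) div 2 \<le> n" "1 \<le> (s + 1) div 2" "(s + 1) div 2 \<le> n"
    by auto
  then show ?thesis
    unfolding e AD_edge_def Let_def AD_vertices_def by auto
qed

lemma prod_AD_edge:
  "(\<Prod>v\<in>AD_edge r s. case v of U i j \<Rightarrow> f i | V i j \<Rightarrow> 1) = (f (r div 2) :: 'a::comm_monoid_mult)"
  by (auto simp: AD_edge_def Let_def elim!: oddE evenE)

lemma prod_AD_vertices:
  "(\<Prod>v\<in>AD_vertices n. case v of U i j \<Rightarrow> f i | V i j \<Rightarrow> 1) = (\<Prod>i\<le>n. f i :: 'a::comm_semiring_1) ^ n"
proof -
  let ?f = "\<lambda>v. case v of U i j \<Rightarrow> f i | V i j \<Rightarrow> 1"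
  have "(\<Prod>v\<in>AD_vertices n. ?f v) = (\<Prod>v\<in>(\<lambda>(i,j). U i j) ` ({..n} \<times> {1..n}). ?f v) *
      (\<Prod>v\<in>(\<lambda>(i,j). V i j) ` ({1..n} \<times> {..n}). ?f v)"
    unfolding AD_vertices_eq by (rule prod.union_disjoint) auto
  also have "(\<Prod>v\<in>(\<lambda>(i,j). V i j) ` ({1..n} \<times> {..n}). ?f v) = 1"
    by (rule prod.neutral) auto
  also have "(\<Prod>v\<in>(\<lambda>(i,j). U i j) ` ({..n} \<times> {1..n}). ?f v) = (\<Prod>(i,j)\<in>{..n} \<times> {1..n}. f i)"
    by (subst prod.reindex) (auto simp: inj_on_def intro!: prod.cong)
  also have "\<dots> = (\<Prod>i\<le>n. f i ^ n)"
    by (subst prod.cartesian_product[symmetric]) simp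
  finally show ?thesis by (simp add: prod_power_distrib)
qed

text \<open>The \<open>U\<close> endpoint of an edge in row \<open>r\<close> has first index
  \<open>r div 2\<close>, and each such index belongs to \<open>n\<close> vertices. A factor
  depending on \<open>r div 2\<close> is thus a vertex factor, to which
  \<open>matching_sum_scale\<close> applies.\<close>

lemma AD_sum_scale_rows:
  "AD_sum n (\<lambda>r s. f (r div 2) * w r s) = (\<Prod>i\<le>n. f i) ^ n * AD_sum n w"
proof -
  let ?f = "\<lambda>v. case v of U i j \<Rightarrow> f i | V i j \<Rightarrow> 1"
  have "AD_sum n (\<lambda>r s. f (r div 2) * w r s) =
     matching_sum (AD_vertices n) (AD_edges n) (\<lambda>e. (\<Prod>v\<in>e. ?f v) * array_weight w e)"
    unfolding AD_sum_def by (rule matching_sum_cong) (auto simp: AD_edges_def prod_AD_edge)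
  also have "\<dots> = (\<Prod>v\<in>AD_vertices n. ?f v) * AD_sum n w"
    unfolding AD_sum_def by (rule matching_sum_scale) (auto dest: AD_edge_subset)
  finally show ?thesis by (simp add: prod_AD_vertices)
qed

subsection \<open>Reduction of Aztec diamonds\<close>

text \<open>Embeds \<open>AD\<^sub>n\<^sub>-\<^sub>1\<close> into \<open>AD\<^sub>n\<close> as the subgraph of interior vertices.\<close>

fun AD_shift :: "vertex \<Rightarrow> vertex" where
  "AD_shift (U i j) = V (i + 1) j"
| "AD_shift (V i j) = U i (j + 1)"

lemma inj_AD_shift: "inj AD_shift"
proof
  fix v w assume "AD_shift v = AD_shift w"
  then show "v = w" by (cases v; cases w) auto
qed

text \<open>Both index parities flip, so each four-cycle of the smaller diamond straddles four
  neighbouring cells of the larger one.\<close>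

lemma AD_shift_image_edge: "AD_shift ` AD_edge r s = AD_edge (r + 1) (s + 1)"
  by (auto simp: AD_edge_def Let_def elim!: oddE evenE)

section \<open>Decomposition of the Aztec diamond into four-cycles\<close>

definition AD_cells :: "nat \<Rightarrow> (nat \<times> nat) set" where
  "AD_cells n = {1..n} \<times> {1..n}"

text \<open>Cell \<open>(i,j)\<close> is the block of edges in rows \<open>2*i-1\<close>,
  \<open>2*i\<close> and columns \<open>2*j-1\<close>, \<open>2*j\<close>. Its corners, in cyclic
  order, are the upper, left, lower and right one.\<close>

definition upper_u :: "nat \<times> nat \<Rightarrow> vertex" where "upper_u = (\<lambda>(i,j). U (i-1) j)"
definition left_v :: "nat \<times> nat \<Rightarrow> vertex" where "left_v = (\<lambda>(i,j). V i (j-1))"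
definition lower_u :: "nat \<times> nat \<Rightarrow> vertex" where "lower_u = (\<lambda>(i,j). U i j)"
definition right_v :: "nat \<times> nat \<Rightarrow> vertex" where "right_v = (\<lambda>(i,j). V i j)"

lemmas corner_defs = upper_u_def left_v_def lower_u_def right_v_def

lemma AD_cell_cycle4:
  assumes "i \<ge> 1" "j \<ge> 1"
  shows "cycle4 (U (i-1) j) (V i (j-1)) (U i j) (V i j) =
    {AD_edge (2*i-1) (2*j-1), AD_edge (2*i) (2*j-1), AD_edge (2*i) (2*j), AD_edge (2*i-1) (2*j)}"
  using assms by (simp only: cycle4_def AD_edge_simps insert_commute)

interpretation AD: cellular_graph "AD_cells n" upper_u left_v lower_u right_v for n
proof
  show "finite (AD_cells n)" by (simp add: AD_cells_def)
  fix c assume c: "c \<in> AD_cells n"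
  then obtain i j where ij: "c = (i,j)" "i \<ge> 1" "j \<ge> 1" by (auto simp: AD_cells_def)
  then show "distinct [upper_u c, left_v c,
      lower_u c, right_v c]" by (auto simp: corner_defs)
  fix c' assume c': "c' \<in> AD_cells n" "c \<noteq> c'"
  then obtain k l where kl: "c' = (k,l)" "k \<ge> 1" "l \<ge> 1" by (auto simp: AD_cells_def)
  have "2*i-1 \<noteq> 2*k" "2*k-1 \<noteq> 2*i" "2*j-1 \<noteq> 2*l" "2*l-1 \<noteq> 2*j"
    "2*i-1 = 2*k-1 \<longleftrightarrow> i = k" "2*j-1 = 2*l-1 \<longleftrightarrow> j = l"
    using ij kl by presburger+
  then show "cycle4 (upper_u c) (left_v c)
      (lower_u c) (right_v c) \<inter>
    cycle4 (upper_u c') (left_v c')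
      (lower_u c') (right_v c') = {}"
    using c' unfolding ij(1) kl(1) corner_defs prod.case AD_cell_cycle4[OF ij(2,3)] AD_cell_cycle4[OF kl(2,3)]
    by (auto simp: AD_edge_inject)
qed

text \<open>A \<open>U\<close> vertex joins vertically adjacent cells, a \<open>V\<close> vertex
  horizontally adjacent ones. Intersecting with \<open>{1..n}\<close> discards neighbours beyond the
  boundary.\<close>

lemma AD_cells_at_U: "AD.cells_at n (U i j) = ({i, i+1} \<inter> {1..n}) \<times> ({j} \<inter> {1..n})"
  unfolding AD.cells_at_def AD.corners_def by (auto simp: AD_cells_def corner_defs)

lemma AD_cells_at_V: "AD.cells_at n (V i j) = ({i} \<inter> {1..n}) \<times> ({j, j+1} \<inter> {1..n})"
  unfolding AD.cells_at_def AD.corners_def by (auto simp: AD_cells_def corner_defs)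

lemma AD_graph_vertices:
  assumes "n \<ge> 1"
  shows "AD.graph_vertices n = AD_vertices n"
proof -
  have "v \<in> AD.graph_vertices n \<longleftrightarrow> AD.cells_at n v \<noteq> {}" for v
    by (auto simp: AD.graph_vertices_def AD.cells_at_def)
  moreover have "AD.cells_at n v \<noteq> {} \<longleftrightarrow> v \<in> AD_vertices n" for v
    using assms by (cases v) (auto simp: AD_cells_at_U AD_cells_at_V AD_vertices_def)
  ultimately show ?thesis by blast
qed

lemma AD_graph_edges: "AD.graph_edges n = AD_edges n"
proof -
  have *: "AD.cell_edges (i,j) = {AD_edge r s | r s. r \<in> {2*i-1, 2*i} \<and> s \<in> {2*j-1, 2*j}}"
    if "i \<ge> 1" "j \<ge> 1" for i j
    unfolding AD.cell_edges_def unfolding corner_defs prod.case AD_cell_cycle4[OF that] by blast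
  show ?thesis
  proof (intro equalityI subsetI)
    fix e assume "e \<in> AD.graph_edges n"
    then obtain i j where "i \<in> {1..n}" "j \<in> {1..n}" "e \<in> AD.cell_edges (i,j)"
      unfolding AD.graph_edges_def by (auto simp: AD_cells_def)
    then show "e \<in> AD_edges n" by (force simp: * AD_edges_def)
  next
    fix e assume "e \<in> AD_edges n"
    then obtain r s where e: "e = AD_edge r s" and rs: "r \<in> {1..2*n}" "s \<in> {1..2*n}"
      by (auto simp: AD_edges_def)
    define i where "i = (r + 1) div 2"
    define j where "j = (s + 1) div 2"
    have "r \<in> {2*i-1, 2*i}" "s \<in> {2*j-1, 2*j}" unfolding i_def j_def by auto
    moreover have ij: "i \<in> {1..n}" "j \<in> {1..n}" using rs unfolding i_def j_def by auto
    ultimately have "e \<in> AD.cell_edges (i,j)" by (auto simp: * e)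
    with ij show "e \<in> AD.graph_edges n" unfolding AD.graph_edges_def unfolding AD_cells_def by blast
  qed
qed

lemma AD_cells_at_le_2: "card (AD.cells_at n v) \<le> 2"
proof (cases v)
  case (U i j)
  have "card (AD.cells_at n v) \<le> card ({i, i+1} \<times> {j})"
    unfolding U AD_cells_at_U by (intro card_mono) auto
  then show ?thesis by simp
next
  case (V i j)
  have "card (AD.cells_at n v) \<le> card ({i} \<times> {j, j+1})"
    unfolding V AD_cells_at_V by (intro card_mono) auto
  then show ?thesis by simp
qed

section \<open>The interior of the Aztec diamond as a diamond of order one less\<close>

lemma AD_interior_U: "U i j \<in> AD.interior_vertices n \<longleftrightarrow> i \<in> {1..<n} \<and> j \<in> {1..n}"
  by (auto simp: AD.interior_vertices_def AD_cells_at_U card_cartesian_product Int_insert_left)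

lemma AD_interior_V: "V i j \<in> AD.interior_vertices n \<longleftrightarrow> i \<in> {1..n} \<and> j \<in> {1..<n}"
  by (auto simp: AD.interior_vertices_def AD_cells_at_V card_cartesian_product Int_insert_left)

lemma AD_interior_vertices:
  assumes "n \<ge> 1"
  shows "AD.interior_vertices n = AD_shift ` AD_vertices (n - 1)"
proof (intro equalityI subsetI)
  fix v assume v: "v \<in> AD.interior_vertices n"
  show "v \<in> AD_shift ` AD_vertices (n - 1)"
  proof (cases v)
    case (U i j)
    with v have "v = AD_shift (V i (j - 1))" "V i (j - 1) \<in> AD_vertices (n - 1)"
      by (auto simp: AD_interior_U AD_vertices_def)
    then show ?thesis by blast
  next
    case (V i j)
    with v have "v = AD_shift (U (i - 1) j)" "U (i - 1) j \<in> AD_vertices (n - 1)"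
      by (auto simp: AD_interior_V AD_vertices_def)
    then show ?thesis by blast
  qed
next
  fix v assume "v \<in> AD_shift ` AD_vertices (n - 1)"
  then show "v \<in> AD.interior_vertices n"
    using assms by (auto simp: AD_vertices_def AD_interior_U AD_interior_V)
qed

text \<open>Rows \<open>1\<close> and \<open>2*n\<close> are those whose \<open>U\<close> endpoints
  have first index \<open>0\<close> or \<open>n\<close>; columns \<open>1\<close> and
  \<open>2*n\<close> play the same part for the second index of \<open>V\<close>.\<close>

lemma AD_edge_interior_iff:
  assumes "r \<in> {1..2*n}" "s \<in> {1..2*n}"
  shows "AD_edge r s \<subseteq> AD.interior_vertices n \<longleftrightarrow> r \<in> {2..2*n-1} \<and> s \<in> {2..2*n-1}"
proof -
  define i where "i = (r + 1) div 2"
  define j where "j = (s + 1) div 2"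
  have r: "r = 2*i-1 \<and> odd r \<or> r = 2*i \<and> even r" unfolding i_def by presburger
  have s: "s = 2*j-1 \<and> odd s \<or> s = 2*j \<and> even s" unfolding j_def by presburger
  have ij: "i \<ge> 1" "j \<ge> 1" "i \<le> n" "j \<le> n" using assms unfolding i_def j_def by auto
  have "AD_edge r s \<subseteq> AD.interior_vertices n \<longleftrightarrow>
      U (if odd r then i - 1 else i) j \<in> AD.interior_vertices n \<and>
      V i (if odd s then j - 1 else j) \<in> AD.interior_vertices n"
    by (simp add: AD_edge_def i_def j_def Let_def)
  also have "\<dots> \<longleftrightarrow> r \<in> {2..2*n-1} \<and> s \<in> {2..2*n-1}"
    unfolding AD_interior_U AD_interior_V using r s ij by (auto; linarith)
  finally show ?thesis .
qed

lemma AD_interior_edges: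
  assumes "n \<ge> 1"
  shows "{e \<in> AD.graph_edges n. e \<subseteq> AD.interior_vertices n} = (`) AD_shift ` AD_edges (n - 1)"
proof (intro equalityI subsetI)
  fix e assume e: "e \<in> {e \<in> AD.graph_edges n. e \<subseteq> AD.interior_vertices n}"
  then obtain r s where rs: "e = AD_edge r s" "r \<in> {1..2*n}" "s \<in> {1..2*n}"
    by (auto simp: AD_graph_edges AD_edges_def)
  with e have "r \<in> {2..2*n-1}" "s \<in> {2..2*n-1}" using AD_edge_interior_iff by auto
  then have "e = AD_shift ` AD_edge (r - 1) (s - 1)" "AD_edge (r - 1) (s - 1) \<in> AD_edges (n - 1)"
    unfolding AD_shift_image_edge AD_edges_def rs(1) by force+
  then show "e \<in> (`) AD_shift ` AD_edges (n - 1)" by blast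
next
  fix e assume "e \<in> (`) AD_shift ` AD_edges (n - 1)"
  then obtain r s where e: "e = AD_edge (r + 1) (s + 1)" and "r \<in> {1..2*(n-1)}" "s \<in> {1..2*(n-1)}"
    by (auto simp: AD_edges_def AD_shift_image_edge)
  then have "r + 1 \<in> {2..2*n-1}" "s + 1 \<in> {2..2*n-1}" "r + 1 \<in> {1..2*n}" "s + 1 \<in> {1..2*n}"
    by auto
  then show "e \<in> {e \<in> AD.graph_edges n. e \<subseteq> AD.interior_vertices n}"
    using AD_edge_interior_iff[of "r + 1" n "s + 1"] e by (auto simp: AD_graph_edges AD_edges_def)
qed

section \<open>Urban renewal in terms of array weights\<close>

definition array_\<Delta> :: "(nat \<Rightarrow> nat \<Rightarrow> 'a::comm_semiring_1) \<Rightarrow> nat \<Rightarrow> nat \<Rightarrow> 'a" where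
  "array_\<Delta> w i j = w (2*i-1) (2*j-1) * w (2*i) (2*j) + w (2*i) (2*j-1) * w (2*i-1) (2*j)"

lemma AD_cell_edge_simps:
  assumes "i \<ge> 1" "j \<ge> 1"
  shows "{U (i-1) j, V i (j-1)} = AD_edge (2*i-1) (2*j-1)"
    "{V i (j-1), U i j} = AD_edge (2*i) (2*j-1)"
    "{U i j, V i j} = AD_edge (2*i) (2*j)"
    "{V i j, U (i-1) j} = AD_edge (2*i-1) (2*j)"
  using assms by (simp_all only: AD_edge_simps insert_commute)

lemma AD_cell_weight:
  assumes "(i,j) \<in> AD_cells n"
  shows "AD.cell_weight (array_weight w) (i,j) = array_\<Delta> w i j"
proof -
  have ij: "i \<ge> 1" "j \<ge> 1" using assms by (auto simp: AD_cells_def)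
  show ?thesis
    unfolding AD.cell_weight_def unfolding corner_defs prod.case AD_cell_edge_simps[OF ij] array_weight_AD_edge
      array_\<Delta>_def ..
qed

text \<open>The row of the opposite edge of the same cell, and likewise the column.\<close>

definition opposite :: "nat \<Rightarrow> nat" where
  "opposite r = (if odd r then r + 1 else r - 1)"

text \<open>Complementation followed by the isomorphism \<open>AD_shift\<close>. Position
  \<open>(r,s)\<close> of the smaller array is position \<open>(r+1,s+1)\<close> of the old one and
  lies in the old cell \<open>(r div 2 + 1, s div 2 + 1)\<close>, whose cross sum is the
  divisor.\<close>

theorem AD_sum_reduction:
  fixes w :: "nat \<Rightarrow> nat \<Rightarrow> 'a::field"
  assumes n: "n \<ge> 1" and nz: "\<And>i j. i \<in> {1..n} \<Longrightarrow> j \<in> {1..n} \<Longrightarrow> array_\<Delta> w i j \<noteq> 0"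
  shows "AD_sum n w = (\<Prod>i=1..n. \<Prod>j=1..n. array_\<Delta> w i j) *
    AD_sum (n - 1) (\<lambda>r s. w (opposite (r + 1)) (opposite (s + 1)) /
      array_\<Delta> w (r div 2 + 1) (s div 2 + 1))"
proof -
  define w' where "w' = (\<lambda>r s. w (opposite r) (opposite s) / array_\<Delta> w ((r + 1) div 2) ((s + 1) div 2))"
  have opp: "opposite (2*k) = 2*k-1" "opposite (2*k-1) = 2*k" "(2*k-1+1) div 2 = k" if "k \<ge> 1" for k
    using that by (auto simp: opposite_def)
  have "AD_sum n w = (\<Prod>c\<in>AD_cells n. AD.cell_weight (array_weight w) c) *
    matching_sum (AD.interior_vertices n) {e \<in> AD.graph_edges n. e \<subseteq> AD.interior_vertices n} (array_weight w')"
    unfolding AD_sum_def AD_graph_vertices[OF n, symmetric] AD_graph_edges[symmetric]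
  proof (rule AD.matching_sum_complement)
    fix c assume c: "c \<in> AD_cells n"
    then obtain i j where ij: "c = (i,j)" "i \<ge> 1" "j \<ge> 1" "i \<le> n" "j \<le> n" by (auto simp: AD_cells_def)
    note cw = AD_cell_weight[OF c[unfolded ij(1)]]
    show "AD.cell_weight (array_weight w) c \<noteq> 0" using nz ij unfolding ij(1) cw by auto
    show "array_weight w' {upper_u c, left_v c} =
        array_weight w {lower_u c, right_v c} / AD.cell_weight (array_weight w) c"
      unfolding ij(1) cw unfolding corner_defs prod.case AD_cell_edge_simps[OF ij(2,3)] array_weight_AD_edge w'_def
      using ij by (simp add: opp del: One_nat_def)
    show "array_weight w' {left_v c, lower_u c} =
        array_weight w {right_v c, upper_u c} / AD.cell_weight (array_weight w) c"
      unfolding ij(1) cw unfolding corner_defs prod.case AD_cell_edge_simps[OF ij(2,3)] array_weight_AD_edge w'_def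
      using ij by (simp add: opp del: One_nat_def)
    show "array_weight w' {lower_u c, right_v c} =
        array_weight w {upper_u c, left_v c} / AD.cell_weight (array_weight w) c"
      unfolding ij(1) cw unfolding corner_defs prod.case AD_cell_edge_simps[OF ij(2,3)] array_weight_AD_edge w'_def
      using ij by (simp add: opp del: One_nat_def)
    show "array_weight w' {right_v c, upper_u c} =
        array_weight w {left_v c, lower_u c} / AD.cell_weight (array_weight w) c"
      unfolding ij(1) cw unfolding corner_defs prod.case AD_cell_edge_simps[OF ij(2,3)] array_weight_AD_edge w'_def
      using ij by (simp add: opp del: One_nat_def)
  qed (rule AD_cells_at_le_2)
  also have "(\<Prod>c\<in>AD_cells n. AD.cell_weight (array_weight w) c) = (\<Prod>(i,j)\<in>AD_cells n. array_\<Delta> w i j)"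
    by (rule prod.cong) (auto simp: AD_cell_weight)
  also have "\<dots> = (\<Prod>i=1..n. \<Prod>j=1..n. array_\<Delta> w i j)"
    unfolding AD_cells_def by (rule prod.cartesian_product[symmetric])
  also have "matching_sum (AD.interior_vertices n) {e \<in> AD.graph_edges n. e \<subseteq> AD.interior_vertices n}
      (array_weight w') = matching_sum (AD_vertices (n - 1)) (AD_edges (n - 1)) (\<lambda>e. array_weight w' (AD_shift ` e))"
    unfolding AD_interior_edges[OF n] unfolding AD_interior_vertices[OF n]
    by (rule matching_sum_image[OF inj_AD_shift])
  also have "\<dots> = AD_sum (n - 1) (\<lambda>r s. w' (r + 1) (s + 1))"
    unfolding AD_sum_def by (rule matching_sum_cong) (auto simp: AD_edges_def AD_shift_image_edge simp del: One_nat_def)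
  finally show ?thesis unfolding w'_def by simp
qed

theorem AD_sum_eq_0:
  assumes "n \<ge> 1" and "\<And>i j. i \<in> {1..n} \<Longrightarrow> j \<in> {1..n} \<Longrightarrow> array_\<Delta> w i j = 0"
  shows "AD_sum n w = 0"
  unfolding AD_sum_def AD_graph_vertices[OF assms(1), symmetric] AD_graph_edges[symmetric]
proof (rule AD.matching_sum_eq_0)
  show "AD.cell_weight (array_weight w) c = 0" if "c \<in> AD_cells n" for c
    using that assms(2) by (cases c) (auto simp: AD_cell_weight AD_cells_def)
  \<comment> \<open>There are \<open>2 * (n * (n + 1))\<close> vertices and \<open>n * n\<close>
    cells.\<close>
  show "2 * card (AD_cells n) < card (AD.graph_vertices n)"
    using assms(1) by (simp add: AD_graph_vertices card_AD_vertices) (simp add: AD_cells_def)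
qed

subsection \<open>The two reduction steps\<close>

lemma mod_4_cases:
  fixes s :: nat
  obtains q where "s = 4 * q" | q where "s = 4 * q + 1" | q where "s = 4 * q + 2" | q where "s = 4 * q + 3"
proof -
  have "s = 4 * (s div 4) + s mod 4" "s mod 4 < 4" by simp_all
  moreover from this(2) consider "s mod 4 = 0" | "s mod 4 = 1" | "s mod 4 = 2" | "s mod 4 = 3"
    by linarith
  ultimately show thesis using that by (metis add_0_right)
qed

lemma double_mod_4:
  fixes j :: nat
  assumes "j \<ge> 1"
  shows "(2*j-1) mod 4 = (if odd j then 1 else 3)" "(2*j) mod 4 = (if odd j then 2 else 0)"
proof -
  have "j = 2 * (j div 2) \<and> j div 2 \<ge> 1 \<or> j = 2 * (j div 2) + 1" using assms by linarith
  then obtain k where "j = 2 * k \<and> k \<ge> 1 \<or> j = 2 * k + 1" by blast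
  moreover have "2 * (2 * k) - 1 = 4 * (k - 1) + 3" if "k \<ge> 1" using that by simp
  moreover have "2 * (2 * k + 1) - 1 = 4 * k + 1" "2 * (2 * k + 1) = 4 * k + 2" by simp_all
  ultimately show "(2*j-1) mod 4 = (if odd j then 1 else 3)" "(2*j) mod 4 = (if odd j then 2 else 0)"
    by (auto simp: mod_Suc)
qed

text \<open>One reduction turns the column pattern with \<open>x\<close> at residues 1 and 0 into
  the one with \<open>x\<close> at residues 1 and 2; a second reduction restores it.\<close>

lemma opposite_Suc_mod_4:
  "opposite (s + 1) mod 4 = 1 \<or> opposite (s + 1) mod 4 = 0 \<longleftrightarrow> s mod 4 = 1 \<or> s mod 4 = 2"
  "opposite (s + 1) mod 4 = 1 \<or> opposite (s + 1) mod 4 = 2 \<longleftrightarrow> s mod 4 = 1 \<or> s mod 4 = 0"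
  by (cases s rule: mod_4_cases; simp add: opposite_def mod_Suc)+

text \<open>In the second reduction the cells of odd column carry \<open>x\<close> and those of even
  column carry \<open>y\<close>. So the cell containing the edge that becomes column
  \<open>s\<close> has the kind prescribed by the restored pattern.\<close>

lemma odd_half_Suc_mod_4:
  fixes s :: nat
  shows "odd (s div 2 + 1) \<longleftrightarrow> s mod 4 = 1 \<or> s mod 4 = 0"
proof -
  have "(4*q) div 2 = 2*q" "(4*q+1) div 2 = 2*q" "(4*q+2) div 2 = 2*q+1" "(4*q+3) div 2 = 2*q+1"
    for q :: nat by linarith+
  then show ?thesis by (cases s rule: mod_4_cases) (simp_all add: mod_Suc)
qed

lemma prod_alternating:
  "(\<Prod>j=1..m. if odd j then a else b) = a ^ ((m + 1) div 2) * (b ^ (m div 2) :: 'a::comm_monoid_mult)"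
  by (induction m) (auto simp: ac_simps elim!: oddE evenE)

text \<open>The second reduction meets the original rows \<open>2*i-1\<close> and
  \<open>2*i+2\<close> in its cell row \<open>i\<close>. These run over all indices except
  \<open>2\<close> and \<open>2*n-1\<close>, the two exceptions in the final product.\<close>

lemma prod_odd_even_split:
  fixes f :: "nat \<Rightarrow> 'a::comm_monoid_mult"
  shows "(\<Prod>i=1..n-1. f (2*i-1) * f (2*i+2)) = (\<Prod>i\<in>{1..2*n} - {2, 2*n-1}. f i)"
proof -
  have "{1..2*n} - {2, 2*n-1} = (\<lambda>i. 2*i-1) ` {1..n-1} \<union> (\<lambda>i. 2*i+2) ` {1..n-1}" (is "_ = ?A \<union> ?B")
  proof (intro equalityI subsetI)
    fix k assume k: "k \<in> {1..2*n} - {2, 2*n-1}"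
    show "k \<in> ?A \<union> ?B"
    proof (cases "odd k")
      case True
      then obtain b where b: "k = 2 * b + 1" by (rule oddE)
      have "2 * b + 1 \<le> 2 * n" "2 * b + 1 \<noteq> 2 * n - 1" using k b by auto
      then have "b < n" "b \<noteq> n - 1" by auto
      then have "b + 1 \<in> {1..n-1}" by auto
      moreover have "k = 2 * (b + 1) - 1" using b by simp
      ultimately show ?thesis by blast
    next
      case False
      then have "k = 2 * (k div 2 - 1) + 2" "k div 2 - 1 \<in> {1..n-1}" using k by (auto elim!: evenE)
      then show ?thesis by blast
    qed
  qed (auto, presburger+)
  moreover have "?A \<inter> ?B = {}" by (auto; presburger)
  moreover have "inj_on (\<lambda>i. 2*i-1) {1..n-1}" "inj_on (\<lambda>i. 2*i+2) {1..n-1}"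
    by (auto simp: inj_on_def)
  ultimately show ?thesis
    by (simp add: prod.union_disjoint prod.reindex prod.distrib)
qed

text \<open>First reduction. All cells in row \<open>i\<close> have cross sum
  \<open>\<Delta> i\<close>, so the cells contribute the \<open>n\<close>-th power of the product of
  the \<open>\<Delta> i\<close>. Extracting the denominators from the new weight removes
  \<open>n-1\<close> of these powers.\<close>

lemma AD_sum_row_constant_cells:
  fixes x y :: "nat \<Rightarrow> 'a::field"
  assumes n: "n \<ge> 1"
    and \<Delta>: "\<And>i. i \<in> {1..n} \<Longrightarrow> \<Delta> i = x (2*i-1) * y (2*i) + x (2*i) * y (2*i-1)"
      "\<And>i. i \<in> {1..n} \<Longrightarrow> \<Delta> i \<noteq> 0"
  shows "AD_sum n (\<lambda>r s. if s mod 4 = 1 \<or> s mod 4 = 0 then x r else y r) = (\<Prod>i=1..n. \<Delta> i) *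
    AD_sum (n-1) (\<lambda>r s. (if s mod 4 = 1 \<or> s mod 4 = 2 then x else y) (opposite (r + 1)))"
proof -
  let ?w = "\<lambda>r s. if s mod 4 = 1 \<or> s mod 4 = 0 then x r else y r"
  let ?w1 = "\<lambda>r s. (if s mod 4 = 1 \<or> s mod 4 = 2 then x else y) (opposite (r + 1))"
  let ?D = "\<Prod>i=1..n. \<Delta> i"
  \<comment> \<open>Changing the parity of \<open>j\<close> swaps the two columns of the block,
    which merely exchanges the two products.\<close>
  have D: "array_\<Delta> ?w i j = \<Delta> i" if "i \<in> {1..n}" "j \<in> {1..n}" for i j
  proof -
    have "j \<ge> 1" using that by simp
    then show ?thesis
      unfolding array_\<Delta>_def double_mod_4[OF \<open>j \<ge> 1\<close>] \<Delta>(1)[OF that(1)] by (simp add: ac_simps)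
  qed
  have "AD_sum n ?w = (\<Prod>i=1..n. \<Prod>j=1..n. array_\<Delta> ?w i j) *
    AD_sum (n-1) (\<lambda>r s. ?w (opposite (r + 1)) (opposite (s + 1)) / array_\<Delta> ?w (r div 2 + 1) (s div 2 + 1))"
    using n D \<Delta>(2) by (intro AD_sum_reduction) auto
  also have "(\<Prod>i=1..n. \<Prod>j=1..n. array_\<Delta> ?w i j) = (\<Prod>i=1..n. \<Prod>j=1..n. \<Delta> i)"
    by (intro prod.cong refl D)
  also have "\<dots> = ?D ^ n" by (simp add: prod_power_distrib)
  also have "AD_sum (n-1) (\<lambda>r s. ?w (opposite (r + 1)) (opposite (s + 1)) / array_\<Delta> ?w (r div 2 + 1) (s div 2 + 1))
      = AD_sum (n-1) (\<lambda>r s. 1 / \<Delta> (r div 2 + 1) * ?w1 r s)"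
  proof (rule AD_sum_cong)
    fix r s assume "r \<in> {1..2*(n-1)}" "s \<in> {1..2*(n-1)}"
    then have "r div 2 + 1 \<in> {1..n}" "s div 2 + 1 \<in> {1..n}" by auto
    then show "?w (opposite (r + 1)) (opposite (s + 1)) / array_\<Delta> ?w (r div 2 + 1) (s div 2 + 1)
        = 1 / \<Delta> (r div 2 + 1) * ?w1 r s"
      unfolding opposite_Suc_mod_4 by (subst D) auto
  qed
  \<comment> \<open>The first indices \<open>0\<close> to \<open>n-1\<close> of the \<open>U\<close>
    vertices of the smaller diamond correspond to the \<open>n\<close> cell rows of the old
    one.\<close>
  also have "\<dots> = (\<Prod>i\<le>n-1. 1 / \<Delta> (i + 1)) ^ (n-1) * AD_sum (n-1) ?w1"
    by (rule AD_sum_scale_rows[where f = "\<lambda>i. 1 / \<Delta> (i + 1)"])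
  also have "(\<Prod>i\<le>n-1. 1 / \<Delta> (i + 1)) = (\<Prod>i=1..n. 1 / \<Delta> i)"
    using n by (intro prod.reindex_bij_witness[where i = "\<lambda>i. i - 1" and j = "\<lambda>i. i + 1"]) auto
  also have "\<dots> = 1 / ?D" by (simp add: prod_dividef)
  also have "?D ^ n * ((1 / ?D) ^ (n-1) * AD_sum (n-1) ?w1) = ?D * AD_sum (n-1) ?w1"
  proof -
    have "?D \<noteq> 0" using \<Delta>(2) by simp
    moreover have "?D ^ n = ?D * ?D ^ (n-1)" using n by (cases n) simp_all
    ultimately show ?thesis by (simp add: power_one_over)
  qed
  finally show ?thesis .
qed

text \<open>Second reduction. Both columns of a cell now carry equal weights, so the two products in
  its cross sum coincide; this is the source of the powers of 2. The exponents of \<open>x\<close>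
  and \<open>y\<close> count the odd and even cell columns among \<open>n-1\<close>.\<close>

lemma AD_sum_equal_column_pairs:
  fixes x y :: "nat \<Rightarrow> 'a::field"
  assumes nz: "\<And>i. i \<in> {1..2*n} \<Longrightarrow> x i \<noteq> 0" "\<And>i. i \<in> {1..2*n} \<Longrightarrow> y i \<noteq> 0" and n: "n \<ge> 1"
  shows "AD_sum (n-1) (\<lambda>r s. (if s mod 4 = 1 \<or> s mod 4 = 2 then x else y) (opposite (r + 1))) =
    2 ^ (n-1) * (\<Prod>i\<in>{1..2*n} - {2, 2*n-1}. x i ^ (n div 2) * y i ^ ((n-1) div 2)) *
    AD_sum (n-2) (\<lambda>r s. 1 / (if s mod 4 = 1 \<or> s mod 4 = 0 then x else y) (if odd r then r + 3 else r + 1))"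
    (is "AD_sum _ ?w1 = _ * AD_sum _ ?w2")
\<comment> \<open>For \<open>n = 1\<close> both orders are \<open>0\<close>, as \<open>n-2\<close>
  truncates, and the index set of the product is empty.\<close>
proof (cases "n = 1")
  case True
  then show ?thesis by simp
next
  case False
  define m where "m = n - 1"
  have m: "m \<ge> 1" "n = m + 1" using False n by (auto simp: m_def)
  let ?z = "\<lambda>j. if odd j then x else y"
  have D: "array_\<Delta> ?w1 i j = 2 * (?z j (2*i-1) * ?z j (2*i+2))" if "i \<in> {1..m}" "j \<in> {1..m}" for i j
  proof -
    \<comment> \<open>After the first reduction, rows \<open>2*i-1\<close> and \<open>2*i\<close>
      carry the entries of the original rows \<open>2*i-1\<close> and \<open>2*i+2\<close>.\<close>
    have "opposite (2*i-1+1) = 2*i-1" "opposite (2*i+1) = 2*i+2"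
      using that by (auto simp: opposite_def)
    then show ?thesis
      using that by (simp add: array_\<Delta>_def double_mod_4 del: One_nat_def)
  qed
  show ?thesis
  proof (cases "(2::'a) = 0")
    case True
    \<comment> \<open>In characteristic 2 the right-hand side vanishes too, since
      \<open>2 ^ (n-1)\<close> has a positive exponent.\<close>
    have "AD_sum m ?w1 = 0"
      using m by (intro AD_sum_eq_0) (simp_all only: D True mult_zero_left)
    then show ?thesis using True m by simp
  next
    case two: False
    have "AD_sum m ?w1 = (\<Prod>i=1..m. \<Prod>j=1..m. array_\<Delta> ?w1 i j) *
      AD_sum (m-1) (\<lambda>r s. ?w1 (opposite (r + 1)) (opposite (s + 1)) / array_\<Delta> ?w1 (r div 2 + 1) (s div 2 + 1))"
    proof (rule AD_sum_reduction[OF m(1)])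
      fix i j assume ij: "i \<in> {1..m}" "j \<in> {1..m}"
      then have "2*i-1 \<in> {1..2*n}" "2*i+2 \<in> {1..2*n}" using m(2) by auto
      then show "array_\<Delta> ?w1 i j \<noteq> 0" using two nz unfolding D[OF ij] by simp
    qed
    also have "(\<Prod>i=1..m. \<Prod>j=1..m. array_\<Delta> ?w1 i j) =
        (\<Prod>i=1..m. \<Prod>j=1..m. 2 * (if odd j then x (2*i-1) * x (2*i+2) else y (2*i-1) * y (2*i+2)))"
      by (intro prod.cong refl) (subst D, auto)
    also have "\<dots> = (\<Prod>i=1..m. 2 ^ m * ((x (2*i-1) * x (2*i+2)) ^ ((m + 1) div 2) *
        (y (2*i-1) * y (2*i+2)) ^ (m div 2)))"
      by (simp add: prod.distrib[of "\<lambda>_. 2"] prod_alternating del: One_nat_def)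
    also have "\<dots> = (2 ^ m) ^ m * (\<Prod>i=1..m. (x (2*i-1) ^ ((m + 1) div 2) * y (2*i-1) ^ (m div 2)) *
         (x (2*i+2) ^ ((m + 1) div 2) * y (2*i+2) ^ (m div 2)))"
      by (subst prod.distrib) (simp add: power_mult_distrib ac_simps)
    also have "\<dots> = (2 ^ m) ^ m * (\<Prod>i\<in>{1..2*n} - {2, 2*n-1}. x i ^ (n div 2) * y i ^ ((n-1) div 2))"
      using prod_odd_even_split[of "\<lambda>i. x i ^ (n div 2) * y i ^ ((n-1) div 2)" n] by (simp add: m(2))
    also have "AD_sum (m-1) (\<lambda>r s. ?w1 (opposite (r + 1)) (opposite (s + 1)) / array_\<Delta> ?w1 (r div 2 + 1) (s div 2 + 1))
        = AD_sum (m-1) (\<lambda>r s. 1 / 2 * ?w2 r s)"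
    proof (rule AD_sum_cong)
      fix r s assume rs: "r \<in> {1..2*(m-1)}" "s \<in> {1..2*(m-1)}"
      define k where "k = r div 2"
      define z where "z = (if s mod 4 = 1 \<or> s mod 4 = 0 then x else y)"
      have k: "k + 1 \<in> {1..m}" "s div 2 + 1 \<in> {1..m}" using rs by (auto simp: k_def)
      have D': "array_\<Delta> ?w1 (k + 1) (s div 2 + 1) = 2 * (z (2*k+1) * z (2*k+4))"
        unfolding D[OF k] odd_half_Suc_mod_4 z_def[symmetric] by (simp add: numeral_eq_Suc)
      have z: "z (2*k+1) \<noteq> 0" "z (2*k+4) \<noteq> 0"
        using k nz m(2) by (auto simp: z_def)
      have "opposite (opposite (r + 1) + 1) = (if odd r then 2*k+1 else 2*k+4)"
        by (auto simp: opposite_def k_def elim!: oddE evenE)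
      then have w: "?w1 (opposite (r + 1)) (opposite (s + 1)) = z (if odd r then 2*k+1 else 2*k+4)"
        unfolding opposite_Suc_mod_4 z_def by (rule arg_cong)
      have "(if odd r then r + 3 else r + 1) = (if odd r then 2*k+4 else 2*k+1)"
        by (auto simp: k_def elim!: oddE evenE)
      then have w2: "?w2 r s = 1 / z (if odd r then 2*k+4 else 2*k+1)"
        unfolding z_def by simp
      \<comment> \<open>The numerator cancels one factor of the cross sum and leaves the reciprocal
        of the other. This produces both the inverted entries and the exchanged rows of
        \<open>t_op\<close>.\<close>
      show "?w1 (opposite (r + 1)) (opposite (s + 1)) / array_\<Delta> ?w1 (r div 2 + 1) (s div 2 + 1)
          = 1 / 2 * ?w2 r s"
        unfolding w w2 k_def[symmetric] D' using z two by (auto simp: field_simps)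
    qed
    also have "\<dots> = (\<Prod>i\<le>m-1. 1 / 2) ^ (m-1) * AD_sum (m-1) ?w2"
      by (rule AD_sum_scale_rows)
    also have "(\<Prod>i\<le>m-1. 1 / 2 :: 'a) = 1 / 2 ^ m"
      using m(1) by (simp add: power_one_over)
    finally have "AD_sum m ?w1 = ((2 ^ m) ^ m * (1 / 2 ^ m) ^ (m-1)) *
        (\<Prod>i\<in>{1..2*n} - {2, 2*n-1}. x i ^ (n div 2) * y i ^ ((n-1) div 2)) * AD_sum (m-1) ?w2"
      by (simp only: ac_simps)
    \<comment> \<open>The \<open>m * m\<close> cells give one factor 2 each, and rescaling the new
      weight takes back \<open>m * (m-1)\<close> of them.\<close>
    also have "((2 ^ m) ^ m * (1 / 2 ^ m) ^ (m-1) :: 'a) = 2 ^ m"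
    proof -
      have "((2 ^ m) ^ m :: 'a) = 2 ^ m * (2 ^ m) ^ (m-1)" using m(1) by (cases m) simp_all
      then show ?thesis using two by (simp add: power_one_over)
    qed
    finally show ?thesis by (simp add: m(2))
  qed
qed

subsection \<open>Indeterminates\<close>

lemma Fract_one_eq_0_iff: "Fract a 1 = 0 \<longleftrightarrow> a = 0"
  by (simp add: Zero_fract_def eq_fract)

lemma indet_neq_0: "indet v \<noteq> (0 :: 'k::field ratfun)"
  unfolding indet_def Fract_one_eq_0_iff by (metis lookup_single_eq lookup_zero zero_neq_one)

text \<open>The variable \<open>a\<close> occurs in the first monomial but not in the second, so the
  monomials differ and cannot cancel, whatever the characteristic.\<close>

lemma indet_mult_add_neq_0:
  assumes "a \<noteq> c" "a \<noteq> d"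
  shows "indet a * indet b + indet c * indet d \<noteq> (0 :: 'k::field ratfun)"
proof -
  let ?v = "\<lambda>i. Poly_Mapping.single i (1::nat)"
  let ?m = "\<lambda>m. Poly_Mapping.single m (1::'k)"
  have "Poly_Mapping.lookup (?v a + ?v b) a \<noteq> Poly_Mapping.lookup (?v c + ?v d) a"
    using assms by (auto simp: Poly_Mapping.lookup_add Poly_Mapping.lookup_single)
  then have "?v c + ?v d \<noteq> ?v a + ?v b" by metis
  then have "Poly_Mapping.lookup (?m (?v a + ?v b) + ?m (?v c + ?v d)) (?v a + ?v b) = 1"
    by (simp add: Poly_Mapping.lookup_add Poly_Mapping.lookup_single)
  then have "?m (?v a + ?v b) + ?m (?v c + ?v d) \<noteq> 0" by auto
  moreover have "indet a * indet b + indet c * indet d = Fract (?m (?v a + ?v b) + ?m (?v c + ?v d)) 1"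
    by (simp add: indet_def mult_single)
  ultimately show ?thesis by (simp add: Fract_one_eq_0_iff)
qed

section \<open>Combination of the two reductions for indeterminate weights\<close>

theorem theorem5p1:
  fixes n :: nat
    and x y \<Delta> :: "nat \<Rightarrow> 'k::field ratfun"
    and T :: "nat \<Rightarrow> 'k ratfun \<times> 'k ratfun"
  assumes "n \<ge> 1"
    and "\<And>i. i \<in> {1..2*n} \<Longrightarrow> x i = indet_x i \<and> y i = indet_y i"
    and "\<And>i. i \<in> {1..2*n} \<Longrightarrow> T i = (x i, y i)"
    and "\<And>i. i \<in> {1..n} \<Longrightarrow> \<Delta> i = x (2*i-1) * y (2*i) + x (2*i) * y (2*i-1)"
  shows "(even n \<longrightarrow>
      M_AD n T =
        2 ^ (n-1) * (\<Prod>i=1..n. \<Delta> i)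
        * (\<Prod>i\<in>{1..2*n} - {2, 2*n-1}. x i ^ (n div 2) * y i ^ (n div 2 - 1))
        * M_AD (n-2) (t_op T)) \<and>
    (odd n \<longrightarrow>
      M_AD n T =
        2 ^ (n-1) * (\<Prod>i=1..n. \<Delta> i)
        * (\<Prod>i\<in>{1..2*n} - {2, 2*n-1}. x i ^ ((n-1) div 2) * y i ^ ((n-1) div 2))
        * (if n = 1 then 1 else M_AD (n-2) (t_op T)))"
proof -
  have nz: "x i \<noteq> 0" "y i \<noteq> 0" if "i \<in> {1..2*n}" for i
    using assms(2)[OF that] by (simp_all add: indet_x_def indet_y_def indet_neq_0)
  have \<Delta>_nz: "\<Delta> i \<noteq> 0" if "i \<in> {1..n}" for i
  proof -
    have "2*i-1 \<in> {1..2*n}" "2*i \<in> {1..2*n}" using that by auto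
    note xy = assms(2)[OF this(1)] assms(2)[OF this(2)]
    \<comment> \<open>The variable index of \<open>x (2*i-1)\<close> differs from those of
      \<open>x (2*i)\<close> and \<open>y (2*i-1)\<close>, the factors of the second
      product.\<close>
    have "2 * (2*i-1) \<noteq> 2 * (2*i)" "2 * (2*i-1) \<noteq> 2 * (2*i-1) + 1" using that by auto
    then show ?thesis
      unfolding assms(4)[OF that] using xy by (simp only: indet_x_def indet_y_def indet_mult_add_neq_0 not_False_eq_True)
  qed
  have "M_AD n T = AD_sum n (\<lambda>r s. if s mod 4 = 1 \<or> s mod 4 = 0 then x r else y r)"
    unfolding M_AD_eq_AD_sum by (rule AD_sum_cong) (auto simp: assms(3))
  also have "\<dots> = (\<Prod>i=1..n. \<Delta> i) *
    AD_sum (n-1) (\<lambda>r s. (if s mod 4 = 1 \<or> s mod 4 = 2 then x else y) (opposite (r + 1)))"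
    using assms(1,4) \<Delta>_nz by (rule AD_sum_row_constant_cells)
  also have "AD_sum (n-1) (\<lambda>r s. (if s mod 4 = 1 \<or> s mod 4 = 2 then x else y) (opposite (r + 1))) =
    2 ^ (n-1) * (\<Prod>i\<in>{1..2*n} - {2, 2*n-1}. x i ^ (n div 2) * y i ^ ((n-1) div 2)) *
    AD_sum (n-2) (\<lambda>r s. 1 / (if s mod 4 = 1 \<or> s mod 4 = 0 then x else y) (if odd r then r + 3 else r + 1))"
    using nz assms(1) by (rule AD_sum_equal_column_pairs)
  also have "AD_sum (n-2) (\<lambda>r s. 1 / (if s mod 4 = 1 \<or> s mod 4 = 0 then x else y) (if odd r then r + 3 else r + 1))
      = M_AD (n-2) (t_op T)"
    unfolding M_AD_eq_AD_sum
  proof (rule AD_sum_cong)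
    fix r s assume r: "r \<in> {1..2*(n-2)}"
    \<comment> \<open>\<open>t_op\<close> reads only meaningful rows of \<open>T\<close>, where
      \<open>assms(3)\<close> applies.\<close>
    have "(if odd r then r + 3 else r + 1) \<in> {1..2*n}" using r by auto
    from assms(3)[OF this]
    show "1 / (if s mod 4 = 1 \<or> s mod 4 = 0 then x else y) (if odd r then r + 3 else r + 1) =
      (if s mod 4 \<in> {1, 0} then fst (t_op T r) else snd (t_op T r))"
      by (simp add: t_op_def)
  qed
  finally have main: "M_AD n T = 2 ^ (n-1) * (\<Prod>i=1..n. \<Delta> i)
      * (\<Prod>i\<in>{1..2*n} - {2, 2*n-1}. x i ^ (n div 2) * y i ^ ((n-1) div 2)) * M_AD (n-2) (t_op T)"
    by (simp only: ac_simps)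
  have "M_AD (n-2) (t_op T) = 1" if "n = 1"
    using that by (simp add: M_AD_eq_AD_sum)
  \<comment> \<open>The exponents \<open>n div 2\<close> and \<open>(n-1) div 2\<close> of
    \<open>main\<close> specialise to those of the two parity cases.\<close>
  moreover have "(n-1) div 2 = n div 2 - 1" if "even n" using that by (auto elim!: evenE)
  moreover have "n div 2 = (n-1) div 2" if "odd n" using that by (auto elim!: oddE)
  ultimately show ?thesis using main by auto
qed

end
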